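(* Let $n\geq 7$, $2\leq l\leq n-4$ and $m=\binom{n}{2}-l$ be integers. Let $A_{n,l}$ be the three-terminal graph with vertex set $\{v_1,\dots,v_n\}$, target vertices $r=v_1$, $s=v_2$, $t=v_3$, and edge set $$E(A_{n,l})=\{v_iv_j : 1\leq i<j\leq n\}\setminus\{v_4v_{i+3} : 2\leq i\leq l+1\}.$$ Then: (1) if $l=3$, the graph $A^*_{n,3}$ obtained from $A_{n,3}$ by adding the edge $v_4v_7$ and deleting the edge $v_5v_6$ is the unique (up to isomorphism of three-terminal graphs) locally most reliable graph in $\mathcal{G}_{n,m}$ for $p$ close to $0$; (2) if $l\neq 3$, the graph $A_{n,l}$ is the unique (up to isomorphism of three-terminal graphs) locally most reliable graph in $\mathcal{G}_{n,m}$ for $p$ close to $0$.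
   Context: A three-terminal graph is a graph with three specified distinct vertices $r,s,t$, called target vertices. $\mathcal{G}_{n,m}$ denotes the set of all simple three-terminal graphs with $n$ vertices and $m$ edges. An isomorphism of three-terminal graphs is a graph isomorphism mapping the set of target vertices onto the set of target vertices. For $G\in\mathcal{G}_{n,m}$ and $p\in[0,1]$, the three-terminal reliability $R_3(G;p)$ is the probability that $r,s,t$ all lie in one connected component of the random spanning subgraph of $G$ in which each edge survives independently with probability $p$. Equivalently, $R_3(G;p)=\sum_{i=2}^{m}N_i(G)p^i(1-p)^{m-i}$, where $N_i(G)$ is the number of $i$-element subsets of $E(G)$ such that $r,s,t$ are all connected to each other using only those edges. A graph $G\in\mathcal{G}_{n,m}$ is a locally most reliable graph in $\mathcal{G}_{n,m}$ for $p$ close to $0$ if there is an $\varepsilon>0$ such that $R_3(G;p)\geq R_3(H;p)$ for all $H\in\mathcal{G}_{n,m}$ and all $p\in[0,1]\cap(-\varepsilon,\varepsilon)$. *)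

theory Defs
  imports "HOL-Probability.Probability"
begin

record 'a tt_graph =
  verts :: "'a set"
  edges :: "'a set set"
  target_r :: 'a
  target_s :: 'a
  target_t :: 'a

definition targets :: "'a tt_graph \<Rightarrow> 'a set" where
  "targets G = {target_r G, target_s G, target_t G}"

definition simple_tt_graph :: "'a tt_graph \<Rightarrow> bool" where
  "simple_tt_graph G \<longleftrightarrow>
     finite (verts G) \<and>
     edges G \<subseteq> {{u, w} | u w. u \<in> verts G \<and> w \<in> verts G \<and> u \<noteq> w} \<and>
     targets G \<subseteq> verts G \<and>
     target_r G \<noteq> target_s G \<and> target_r G \<noteq> target_t G \<and> target_s G \<noteq> target_t G"

definition tt_graphs :: "nat \<Rightarrow> nat \<Rightarrow> 'a tt_graph set" where
  "tt_graphs n m = {G. simple_tt_graph G \<and> card (verts G) = n \<and> card (edges G) = m}"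

definition tt_isomorphic :: "'a tt_graph \<Rightarrow> 'b tt_graph \<Rightarrow> bool" where
  "tt_isomorphic G H \<longleftrightarrow>
     (\<exists>f. bij_betw f (verts G) (verts H) \<and>
          (\<forall>u \<in> verts G. \<forall>w \<in> verts G. {u, w} \<in> edges G \<longleftrightarrow> {f u, f w} \<in> edges H) \<and>
          f ` targets G = targets H)"

definition adjacency :: "'a set set \<Rightarrow> ('a \<times> 'a) set" where
  "adjacency F = {(u, w). {u, w} \<in> F}"

definition targets_connected :: "'a tt_graph \<Rightarrow> 'a set set \<Rightarrow> bool" where
  "targets_connected G F \<longleftrightarrow>
     (\<forall>x \<in> targets G. \<forall>y \<in> targets G. (x, y) \<in> (adjacency F)\<^sup>*)"

text \<open>
  An outcome \<open>\<omega>\<close> tells for every edge whether it survives. \<^const>\<open>bernoulli_pmf\<close> truncates its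
  parameter to the unit interval, so this is the reliability only for \<open>0 \<le> p \<le> 1\<close>.
\<close>

definition reliability3 :: "'a tt_graph \<Rightarrow> real \<Rightarrow> real" where
  "reliability3 G p =
     measure_pmf.prob (Pi_pmf (edges G) False (\<lambda>_. bernoulli_pmf p))
       {\<omega>. targets_connected G {e \<in> edges G. \<omega> e}}"

definition locally_most_reliable_near_0 :: "nat \<Rightarrow> nat \<Rightarrow> 'a tt_graph \<Rightarrow> bool" where
  "locally_most_reliable_near_0 n m G \<longleftrightarrow>
     G \<in> tt_graphs n m \<and>
     (\<exists>\<epsilon>>0. \<forall>H \<in> (tt_graphs n m :: 'a tt_graph set). \<forall>p \<in> {0..1} \<inter> {-\<epsilon><..<\<epsilon>}.
        reliability3 G p \<ge> reliability3 H p)"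

definition unique_locally_most_reliable_near_0 :: "nat \<Rightarrow> nat \<Rightarrow> 'a tt_graph \<Rightarrow> bool" where
  "unique_locally_most_reliable_near_0 n m G \<longleftrightarrow>
     locally_most_reliable_near_0 n m G \<and>
     (\<forall>H :: 'a tt_graph. locally_most_reliable_near_0 n m H \<longrightarrow> tt_isomorphic G H)"

text \<open>
  The vertices \<open>v\<^sub>1, \<dots>, v\<^sub>n\<close> are given by a labelling \<open>v\<close>, to be used with \<open>inj_on v {1..n}\<close>.
\<close>

definition graph_A :: "(nat \<Rightarrow> 'a) \<Rightarrow> nat \<Rightarrow> nat \<Rightarrow> 'a tt_graph" where
  "graph_A v n l =
     \<lparr>verts = v ` {1..n},
      edges = {{v i, v j} | i j. 1 \<le> i \<and> i < j \<and> j \<le> n} -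
              {{v 4, v (i + 3)} | i. 2 \<le> i \<and> i \<le> l + 1},
      target_r = v 1, target_s = v 2, target_t = v 3\<rparr>"

definition graph_A_star :: "(nat \<Rightarrow> 'a) \<Rightarrow> nat \<Rightarrow> 'a tt_graph" where
  "graph_A_star v n =
     (graph_A v n 3)\<lparr>edges := (edges (graph_A v n 3) \<union> {{v 4, v 7}}) - {{v 5, v 6}}\<rparr>"

end

theory Submission
  imports Defs
begin

text \<open>
  Write \<open>N\<^sub>i G\<close> for the number of \<open>i\<close>-element edge sets of \<open>G\<close> that connect the targets. Since
  \<open>R\<^sub>3(G;p)\<close> is the sum of \<open>N\<^sub>i G p\<^sup>i (1 - p)\<^sup>m\<^sup>-\<^sup>i\<close> and the coefficients are bounded by \<open>2\<^sup>m\<close>, comparing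
  reliabilities for \<open>p\<close> close to \<open>0\<close> means comparing the sequences \<open>(N\<^sub>i)\<close> lexicographically, with
  one \<open>\<epsilon>\<close> for all competitors. It therefore suffices that every graph with the same parameters is
  isomorphic to the claimed optimum or has a lexicographically smaller sequence
  (\<open>unique_locally_most_reliable_if_lex_greatest\<close>).

  A graph is described by its set \<open>D\<close> of \<open>l\<close> missing edges. Both graphs of the theorem miss only inner
  edges, that is, edges between two vertices that are not targets, and any two of their missing
  edges meet: they form a star or a triangle. A competitor loses at the following place.
  \<^item> If \<open>D\<close> contains an edge between two targets, it loses at \<open>N\<^sub>2\<close>, because a connecting pair consists
    of two such edges.
  \<^item> Otherwise, if \<open>D\<close> contains an edge at a target, it loses at \<open>N\<^sub>3\<close>. The connecting sets with two
    edges between targets are equally many for all such sets \<open>D\<close>; every other connecting set (a \<open>thin\<close>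
    one) contains at least three edges that are not inner (\<open>thin_outer_ge_3\<close>), so a thin set of
    three edges has no inner edge and survives the deletion of inner edges.
  \<^item> If \<open>D\<close> is inner, inclusion and exclusion write the number of thin \<open>i\<close>-sets avoiding \<open>D\<close> as the
    alternating sum, over \<open>X \<subseteq> D\<close>, of the numbers of thin \<open>i\<close>-sets containing \<open>X\<close>. These vanish for
    \<open>i < card X + 3\<close>, and for \<open>card X \<le> 1\<close> they do not depend on the choice of \<open>X\<close>. So \<open>N\<^sub>4\<close> does not
    distinguish such \<open>D\<close>, and \<open>N\<^sub>5\<close> counts, up to constants, the pairs of missing edges that meet,
    provided that a path of two edges lies in more thin sets of size five than two disjoint edges
    do (\<open>card_links_path_gt_matching\<close>). All pairs meet only in a star or a triangle
    (\<open>pairwise_meeting_cases\<close>).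
  \<^item> If \<open>l = 3\<close>, star and triangle agree up to \<open>N\<^sub>5\<close>. In \<open>N\<^sub>6\<close> they differ by the term \<open>X = D\<close> only, which
    has a negative sign and is larger for the star (\<open>card_links_triangle_lt_star\<close>). So the triangle
    wins.

  Both comparisons of patterns \<open>X\<close> rest on \<open>links_iff\<close>: three outer edges, at most one of them
  between targets, that connect the targets when all inner edges are present still do so with the
  inner edges \<open>X\<close> alone exactly if their endpoints outside the targets lie in one component of \<open>X\<close>.
  So a pattern is better the more sets of
  vertices it holds together. A path of two edges holds together the same sets as its two edges do
  separately and the two ends in addition; a star with three edges reaches four vertices, a
  triangle only three.
\<close>

section \<open>Edge sets and their images\<close>

definition pairs :: "'a set \<Rightarrow> 'a set set" where
  "pairs S = {e. e \<subseteq> S \<and> card e = 2}"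

definition num_connecting :: "'a tt_graph \<Rightarrow> nat \<Rightarrow> nat" where
  "num_connecting G i = card {F. F \<subseteq> edges G \<and> card F = i \<and> targets_connected G F}"

lemma finite_pairs: "finite S \<Longrightarrow> finite (pairs S)"
  unfolding pairs_def by (rule finite_subset[of _ "Pow S"]) auto

lemma pairs_iff: "pairs S = {{u, w} | u w. u \<in> S \<and> w \<in> S \<and> u \<noteq> w}"
  unfolding pairs_def by (auto simp: card_2_iff)

text \<open>
  The invariance of the counts under isomorphisms, under symmetries, and under exchanges of edges that
  do not come from vertex maps is obtained from this by giving \<open>h\<close>.
\<close>
lemma card_family_image:
  assumes h: "bij_betw h A B" and PQ: "\<And>F. F \<subseteq> A \<Longrightarrow> P F \<longleftrightarrow> Q (h ` F)"
  shows "card {F. F \<subseteq> A \<and> P F} = card {F. F \<subseteq> B \<and> Q F}"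
proof -
  have "bij_betw ((`) h) (Pow A) (Pow B)"
    using h by (rule bij_betw_Pow)
  then have "bij_betw ((`) h) {F. F \<subseteq> A \<and> P F} {F. F \<subseteq> B \<and> Q F}"
    unfolding bij_betw_def
  proof (intro conjI, goal_cases)
    case 1 then show ?case by (auto intro: inj_on_subset)
  next
    case 2
    then have im: "(`) h ` Pow A = Pow B" by simp
    show ?case
    proof (intro equalityI subsetI)
      fix F assume "F \<in> (`) h ` {F. F \<subseteq> A \<and> P F}"
      with PQ im show "F \<in> {F. F \<subseteq> B \<and> Q F}" by auto
    next
      fix F assume F: "F \<in> {F. F \<subseteq> B \<and> Q F}"
      then have "F \<in> (`) h ` Pow A" using im by auto
      with F PQ show "F \<in> (`) h ` {F. F \<subseteq> A \<and> P F}" by auto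
    qed
  qed
  then show ?thesis by (rule bij_betw_same_card)
qed

lemma card_image_subset:
  assumes "inj_on h A" "F \<subseteq> A" shows "card (h ` F) = card F"
  using assms by (meson card_image inj_on_subset)

section \<open>Reliability near zero as a lexicographic order\<close>

lemma reliability3_expansion:
  assumes fin: "finite (edges G)" and p: "0 \<le> p" "p \<le> 1" and m: "card (edges G) = m"
  shows "reliability3 G p = (\<Sum>i\<le>m. real (num_connecting G i) * (p ^ i * (1 - p) ^ (m - i)))"
proof -
  let ?E = "edges G"
  let ?M = "Pi_pmf ?E False (\<lambda>_. bernoulli_pmf p)"
  let ?\<F> = "{F. F \<subseteq> ?E \<and> targets_connected G F}"
  define ind where "ind F = (\<lambda>e. e \<in> F)" for F :: "'a set set"
  have finF: "finite ?\<F>" using fin by auto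
  have supp: "set_pmf ?M \<subseteq> ind ` Pow ?E"
  proof
    fix \<omega> assume "\<omega> \<in> set_pmf ?M"
    then have "\<forall>e. e \<notin> ?E \<longrightarrow> \<not> \<omega> e"
      using set_Pi_pmf_subset[OF fin, of False "\<lambda>_. bernoulli_pmf p"] by auto
    then have "\<omega> = ind {e \<in> ?E. \<omega> e}" unfolding ind_def by auto
    then show "\<omega> \<in> ind ` Pow ?E" by blast
  qed
  have sel: "{e \<in> ?E. ind F e} = F" if "F \<subseteq> ?E" for F
    using that by (auto simp: ind_def)
  have "reliability3 G p = measure_pmf.prob ?M (ind ` ?\<F>)"
    unfolding reliability3_def
  proof (rule measure_prob_cong_0)
    fix \<omega> assume "\<omega> \<in> {\<omega>. targets_connected G {e \<in> ?E. \<omega> e}} - ind ` ?\<F>"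
    moreover have "\<omega> \<in> ind ` Pow ?E \<Longrightarrow> targets_connected G {e \<in> ?E. \<omega> e} \<Longrightarrow> \<omega> \<in> ind ` ?\<F>"
      using sel by fastforce
    ultimately have "\<omega> \<notin> set_pmf ?M" using supp by blast
    then show "pmf ?M \<omega> = 0" by (simp add: set_pmf_iff)
  next
    fix \<omega> assume "\<omega> \<in> ind ` ?\<F> - {\<omega>. targets_connected G {e \<in> ?E. \<omega> e}}"
    then show "pmf ?M \<omega> = 0" using sel by auto
  qed
  also have "\<dots> = (\<Sum>\<omega>\<in>ind ` ?\<F>. pmf ?M \<omega>)"
    using finF by (simp add: measure_measure_pmf_finite)
  also have "\<dots> = (\<Sum>F\<in>?\<F>. pmf ?M (ind F))"
    by (subst sum.reindex) (auto simp: inj_on_def ind_def fun_eq_iff)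
  also have "\<dots> = (\<Sum>F\<in>?\<F>. p ^ card F * (1 - p) ^ (m - card F))"
  proof (rule sum.cong)
    fix F assume F: "F \<in> ?\<F>"
    have "pmf ?M (ind F) = (\<Prod>e\<in>?E. pmf (bernoulli_pmf p) (ind F e))"
      using F fin by (intro pmf_Pi') (auto simp: ind_def)
    also have "\<dots> = (\<Prod>e\<in>?E. if e \<in> F then p else 1 - p)"
      using p by (intro prod.cong) (auto simp: ind_def)
    also have "\<dots> = p ^ card F * (1 - p) ^ card (?E - F)"
      using F fin by (simp add: prod.If_cases Int_absorb1 Diff_eq flip: Collect_neg_eq)
    also have "card (?E - F) = m - card F"
      using F fin m by (auto intro: card_Diff_subset finite_subset)
    finally show "pmf ?M (ind F) = p ^ card F * (1 - p) ^ (m - card F)" .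
  qed simp
  also have "\<dots> = (\<Sum>i\<le>m. \<Sum>F\<in>{F \<in> ?\<F>. card F = i}. p ^ card F * (1 - p) ^ (m - card F))"
    using finF fin m by (intro sum.group[symmetric]) (auto intro: card_mono)
  also have "\<dots> = (\<Sum>i\<le>m. real (num_connecting G i) * (p ^ i * (1 - p) ^ (m - i)))"
  proof (rule sum.cong)
    fix i
    have "{F \<in> ?\<F>. card F = i} = {F. F \<subseteq> ?E \<and> card F = i \<and> targets_connected G F}" by auto
    then show "(\<Sum>F\<in>{F \<in> ?\<F>. card F = i}. p ^ card F * (1 - p) ^ (m - card F))
        = real (num_connecting G i) * (p ^ i * (1 - p) ^ (m - i))"
      by (simp add: num_connecting_def)
  qed simp
  finally show ?thesis .
qed

text \<open>
  The least index with a strict inequality shows that this is the usual lexicographic order; with \<open>\<le>\<close>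
  before \<open>k\<close>, inclusions between families of edge sets can be used directly.
\<close>
definition lex_less :: "(nat \<Rightarrow> nat) \<Rightarrow> (nat \<Rightarrow> nat) \<Rightarrow> bool" where
  "lex_less a b \<longleftrightarrow> (\<exists>k. (\<forall>i<k. a i \<le> b i) \<and> a k < b k)"

text \<open>
  The term at \<open>k\<close> wins by at least \<open>p\<^sup>k (1 - p)\<^sup>m\<^sup>-\<^sup>k \<ge> p\<^sup>k (1 - m p)\<close>, while each later term loses at most
  \<open>B p\<^sup>k\<^sup>+\<^sup>1\<close>. The resulting range of \<open>p\<close> involves only \<open>m\<close> and \<open>B\<close>; this makes it uniform over the
  possibly infinite class of competitors.
\<close>
lemma bernstein_sum_less:
  fixes a b :: "nat \<Rightarrow> nat" and p :: real
  assumes ab: "\<forall>i<k. a i \<le> b i" "a k < b k" and k: "k \<le> m"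
    and B: "\<And>i. a i \<le> B" and p: "0 < p" "p * (real m * (real B + 1) + 1) < 1"
  shows "(\<Sum>i\<le>m. real (a i) * (p ^ i * (1 - p) ^ (m - i)))
       < (\<Sum>i\<le>m. real (b i) * (p ^ i * (1 - p) ^ (m - i)))"
proof -
  let ?w = "\<lambda>i. p ^ i * (1 - p) ^ (m - i)"
  have "p * 1 \<le> p * (real m * (real B + 1) + 1)"
    using p(1) by (intro mult_left_mono) auto
  then have p1: "p < 1" using p(2) by simp
  have w0: "0 \<le> ?w i" for i using p p1 by simp
  have tail: "- (real B * p ^ Suc k) \<le> (real (b i) - real (a i)) * ?w i" if i: "i \<in> {k<..m}" for i
  proof -
    have "?w i \<le> p ^ i * 1" using p p1 by (intro mult_left_mono power_le_one) auto
    also have "\<dots> \<le> p ^ Suc k" using i p p1 by (simp add: power_decreasing del: power_Suc)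
    finally have "real B * ?w i \<le> real B * p ^ Suc k" by (rule mult_left_mono) simp
    moreover have "- (real B) * ?w i \<le> (real (b i) - real (a i)) * ?w i"
    proof (rule mult_right_mono)
      have "real (a i) \<le> real B" using B by simp
      then show "- real B \<le> real (b i) - real (a i)" by simp
    qed (rule w0)
    ultimately show ?thesis by simp
  qed
  have "1 - real m * p \<le> (1 - p) ^ m"
    using Bernoulli_inequality[of "- p" m] p1 by simp
  also have "\<dots> \<le> (1 - p) ^ (m - k)" using p p1 by (intro power_decreasing) auto
  finally have one: "1 - real m * p \<le> (1 - p) ^ (m - k)" .
  have "0 < p ^ k * (1 - real m * p - real m * real B * p)"
    using p p1 by (intro mult_pos_pos) (auto simp: algebra_simps)
  also have "\<dots> \<le> p ^ k * ((1 - p) ^ (m - k) - real m * real B * p)"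
    using p one by (intro mult_left_mono) auto
  also have "\<dots> = ?w k - real m * (real B * p ^ Suc k)" by (simp add: algebra_simps)
  also have "\<dots> \<le> ?w k - real (card {k<..m}) * (real B * p ^ Suc k)"
    using p by (intro diff_left_mono mult_right_mono) auto
  also have "\<dots> = ?w k + (\<Sum>i\<in>{k<..m}. - (real B * p ^ Suc k))" by simp
  also have "\<dots> \<le> (real (b k) - real (a k)) * ?w k + (\<Sum>i\<in>{k<..m}. (real (b i) - real (a i)) * ?w i)"
  proof (rule add_mono)
    have "1 * ?w k \<le> (real (b k) - real (a k)) * ?w k"
      using ab(2) by (intro mult_right_mono w0) linarith
    then show "?w k \<le> (real (b k) - real (a k)) * ?w k" by simp
  qed (rule sum_mono[OF tail])
  also have "\<dots> = (\<Sum>i\<in>{k..m}. (real (b i) - real (a i)) * ?w i)"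
  proof -
    have "{k..m} = insert k {k<..m}" using k by auto
    then show ?thesis by simp
  qed
  also have "\<dots> \<le> (\<Sum>i\<le>m. (real (b i) - real (a i)) * ?w i)"
    by (rule sum_mono2) (use ab(1) p p1 in \<open>auto intro!: mult_nonneg_nonneg\<close>)
  finally show ?thesis by (simp add: algebra_simps sum_subtractf)
qed

lemma num_connecting_le:
  assumes "finite (edges G)" "card (edges G) = m"
  shows "num_connecting G i \<le> 2 ^ m"
proof -
  have "num_connecting G i \<le> card (Pow (edges G))"
    unfolding num_connecting_def using assms(1) by (intro card_mono) auto
  then show ?thesis using assms by (simp add: card_Pow)
qed

lemma num_connecting_pos_le:
  assumes "finite (edges G)" "0 < num_connecting G i"
  shows "i \<le> card (edges G)"
proof -
  have "{F. F \<subseteq> edges G \<and> card F = i \<and> targets_connected G F} \<noteq> {}"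
    using assms(2) unfolding num_connecting_def by (metis card.empty less_irrefl)
  then show ?thesis using assms(1) card_mono by auto
qed

section \<open>Invariance under isomorphism\<close>

lemma simple_edges_pairs: "simple_tt_graph G \<Longrightarrow> edges G \<subseteq> pairs (verts G)"
  unfolding simple_tt_graph_def pairs_iff by blast

lemma simple_finite_edges: "simple_tt_graph G \<Longrightarrow> finite (edges G)"
  using simple_edges_pairs[of G] finite_pairs[of "verts G"] finite_subset
  unfolding simple_tt_graph_def by blast

lemma reach_image:
  assumes "(x, y) \<in> (adjacency F)\<^sup>*"
  shows "(f x, f y) \<in> (adjacency ((`) f ` F))\<^sup>*"
  using assms
proof induction
  case (step y z)
  then have "{y, z} \<in> F" by (simp add: adjacency_def)
  then have "f ` {y, z} \<in> (`) f ` F" by blast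
  then have "(f y, f z) \<in> adjacency ((`) f ` F)" by (simp add: adjacency_def)
  with step.IH show ?case by (rule rtrancl_into_rtrancl)
qed simp

lemma reach_image_iff:
  assumes f: "inj_on f V" and F: "F \<subseteq> Pow V" and xy: "x \<in> V" "y \<in> V"
  shows "(f x, f y) \<in> (adjacency ((`) f ` F))\<^sup>* \<longleftrightarrow> (x, y) \<in> (adjacency F)\<^sup>*"
proof
  let ?g = "inv_into V f"
  assume "(f x, f y) \<in> (adjacency ((`) f ` F))\<^sup>*"
  then have "(?g (f x), ?g (f y)) \<in> (adjacency ((`) ?g ` (`) f ` F))\<^sup>*" by (rule reach_image)
  moreover have "(`) ?g ` (`) f ` F = F"
  proof -
    have "?g ` f ` e = e" if "e \<in> F" for e
      using that F f by (intro inv_into_image_cancel) auto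
    then show ?thesis by (force simp: image_image)
  qed
  ultimately show "(x, y) \<in> (adjacency F)\<^sup>*" using f xy by simp
qed (rule reach_image)

lemma inj_on_image_Pow_subset: "inj_on f V \<Longrightarrow> \<E> \<subseteq> Pow V \<Longrightarrow> inj_on ((`) f) \<E>"
  by (meson inj_on_image_Pow inj_on_subset)

lemma pairs_subset_Pow: "pairs V \<subseteq> Pow V"
  by (auto simp: pairs_def)

lemma bij_betw_image_pairs:
  assumes "bij_betw f V V'" shows "bij_betw ((`) f) (pairs V) (pairs V')"
proof -
  have inj: "inj_on f V" and im: "f ` V = V'" using assms by (auto simp: bij_betw_def)
  have "(`) f ` pairs V = pairs V'"
  proof (intro equalityI subsetI)
    fix e assume "e \<in> (`) f ` pairs V"
    then show "e \<in> pairs V'" using inj im card_image_subset[OF inj] by (auto simp: pairs_def)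
  next
    fix e assume e: "e \<in> pairs V'"
    then obtain d where d: "d \<subseteq> V" "e = f ` d" using im by (auto simp: pairs_def subset_image_iff)
    then have "d \<in> pairs V" using e card_image_subset[OF inj, of d] by (simp add: pairs_def)
    with d show "e \<in> (`) f ` pairs V" by blast
  qed
  then show ?thesis
    using inj_on_image_Pow_subset[OF inj pairs_subset_Pow] by (simp add: bij_betw_def)
qed

lemma num_connecting_isomorphic:
  assumes G: "simple_tt_graph G" and H: "simple_tt_graph H" and iso: "tt_isomorphic G H"
  shows "num_connecting G i = num_connecting H i"
proof -
  obtain f where f: "bij_betw f (verts G) (verts H)" and fT: "f ` targets G = targets H"
    and adj: "\<And>u w. u \<in> verts G \<Longrightarrow> w \<in> verts G \<Longrightarrow> {u, w} \<in> edges G \<longleftrightarrow> {f u, f w} \<in> edges H"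
    using iso unfolding tt_isomorphic_def by auto
  have inj: "inj_on f (verts G)" and im: "f ` verts G = verts H" using f by (auto simp: bij_betw_def)
  have EG: "edges G \<subseteq> Pow (verts G)" using simple_edges_pairs[OF G] pairs_subset_Pow by blast
  have injE: "inj_on ((`) f) (edges G)" by (rule inj_on_image_Pow_subset[OF inj EG])
  have "(`) f ` edges G = edges H"
  proof (intro equalityI subsetI)
    fix e assume "e \<in> (`) f ` edges G"
    then obtain d where d: "d \<in> edges G" "e = f ` d" by blast
    then have "d \<in> pairs (verts G)" using simple_edges_pairs[OF G] by blast
    then obtain u w where "d = {u, w}" "u \<in> verts G" "w \<in> verts G"
      unfolding pairs_iff by blast
    then show "e \<in> edges H" using d adj by simp
  next
    fix e assume e: "e \<in> edges H"
    then have "e \<in> pairs (verts H)" using simple_edges_pairs[OF H] by blast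
    then obtain a b where ab: "e = {a, b}" "a \<in> f ` verts G" "b \<in> f ` verts G"
      unfolding pairs_iff im by blast
    then obtain u w where uw: "e = {f u, f w}" "u \<in> verts G" "w \<in> verts G" by blast
    then have "{u, w} \<in> edges G" using e adj by simp
    then show "e \<in> (`) f ` edges G" using uw by (intro image_eqI[of _ _ "{u, w}"]) auto
  qed
  then have bij: "bij_betw ((`) f) (edges G) (edges H)" using injE by (simp add: bij_betw_def)
  have TG: "targets G \<subseteq> verts G" using G by (simp add: simple_tt_graph_def)
  have "targets_connected G F \<longleftrightarrow> targets_connected H ((`) f ` F)" if "F \<subseteq> edges G" for F
  proof -
    have "F \<subseteq> Pow (verts G)" using that EG by blast
    then have "(f x, f y) \<in> (adjacency ((`) f ` F))\<^sup>* \<longleftrightarrow> (x, y) \<in> (adjacency F)\<^sup>*"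
      if "x \<in> targets G" "y \<in> targets G" for x y
      using reach_image_iff[OF inj, of F x y] that TG by blast
    then show ?thesis
      unfolding targets_connected_def fT[symmetric] by simp
  qed
  then show ?thesis
    unfolding num_connecting_def
    by (intro card_family_image[OF bij]) (simp add: card_image_subset[OF injE])
qed

section \<open>A criterion for unique optimality\<close>

lemma unique_locally_most_reliable_if_lex_greatest:
  fixes G :: "'a tt_graph"
  assumes G: "G \<in> tt_graphs n m"
    and dich: "\<And>H :: 'a tt_graph. H \<in> tt_graphs n m \<Longrightarrow>
      tt_isomorphic G H \<or> lex_less (num_connecting H) (num_connecting G)"
  shows "unique_locally_most_reliable_near_0 n m G"
proof -
  \<comment> \<open>The bound \<open>2 ^ m\<close> on the coefficients, put into the range of \<open>bernstein_sum_less\<close>.\<close>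
  define \<delta> :: real where "\<delta> = 1 / (real m * (2 ^ m + 1) + 1)"
  have den: "0 < real m * (2 ^ m + 1) + (1::real)" by (simp add: add_nonneg_pos)
  then have \<delta>: "0 < \<delta>" by (simp add: \<delta>_def)
  have expand: "reliability3 H p
      = (\<Sum>i\<le>m. real (num_connecting H i) * (p ^ i * (1 - p) ^ (m - i)))"
    if "H \<in> tt_graphs n m" "0 \<le> p" "p \<le> 1" for p and H :: "'a tt_graph"
    using that simple_finite_edges[of H] by (intro reliability3_expansion) (auto simp: tt_graphs_def)
  have less: "reliability3 H p < reliability3 G p"
    if H: "H \<in> tt_graphs n m" and lex: "lex_less (num_connecting H) (num_connecting G)"
      and p: "0 < p" "p < \<delta>" "p \<le> 1" for H :: "'a tt_graph" and p
  proof -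
    obtain k where k: "\<forall>i<k. num_connecting H i \<le> num_connecting G i"
      "num_connecting H k < num_connecting G k"
      using lex by (auto simp: lex_less_def)
    have "k \<le> m" using num_connecting_pos_le[of G k] k(2) G simple_finite_edges[of G]
      by (auto simp: tt_graphs_def)
    moreover have "num_connecting H i \<le> 2 ^ m" for i
      using H simple_finite_edges[of H] num_connecting_le[of H m i] by (auto simp: tt_graphs_def)
    moreover have "p * (real m * (real (2 ^ m) + 1) + 1) < 1"
      using p(2) den by (simp add: \<delta>_def pos_less_divide_eq)
    ultimately show ?thesis
      using expand[OF H, of p] expand[OF G, of p] p bernstein_sum_less[OF k, of m "2 ^ m" p] by simp
  qed
  have eq: "reliability3 H p = reliability3 G p"
    if "H \<in> tt_graphs n m" "tt_isomorphic G H" "0 \<le> p" "p \<le> 1" for H :: "'a tt_graph" and p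
    using that G expand num_connecting_isomorphic[of G H] by (simp add: tt_graphs_def)
  have zero: "num_connecting H 0 = 0" if "H \<in> tt_graphs n m" for H :: "'a tt_graph"
  proof -
    have "\<not> targets_connected H {}"
      using that by (auto simp: targets_connected_def adjacency_def tt_graphs_def
          simple_tt_graph_def targets_def)
    moreover have "card F = 0 \<longleftrightarrow> F = {}" if "F \<subseteq> edges H" for F
      using that \<open>H \<in> tt_graphs n m\<close> simple_finite_edges[of H]
      by (auto simp: tt_graphs_def finite_subset)
    ultimately have no: "{F. F \<subseteq> edges H \<and> card F = 0 \<and> targets_connected H F} = {}" by blast
    show ?thesis unfolding num_connecting_def no by simp
  qed
  have at0: "reliability3 H 0 = 0" if H: "H \<in> tt_graphs n m" for H :: "'a tt_graph"
  proof -
    have "real (num_connecting H i) * (0 ^ i * (1 - 0) ^ (m - i)) = 0" for i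
      using zero[OF H] by (cases i) auto
    then show ?thesis using expand[OF H, of 0] by (simp add: zero[OF H])
  qed
  have "reliability3 H p \<le> reliability3 G p"
    if H: "H \<in> tt_graphs n m" and p: "p \<in> {0..1} \<inter> {-\<delta><..<\<delta>}" for H :: "'a tt_graph" and p
  proof (cases "p = 0")
    case False
    with p have "0 < p" "p < \<delta>" "p \<le> 1" by auto
    then show ?thesis using dich[OF H] less[OF H, of p] eq[OF H, of p] by fastforce
  qed (simp add: at0[OF H] at0[OF G])
  then have "locally_most_reliable_near_0 n m G"
    unfolding locally_most_reliable_near_0_def using G \<delta> by blast
  moreover have "tt_isomorphic G H" if lmr: "locally_most_reliable_near_0 n m H" for H :: "'a tt_graph"
  proof (rule ccontr)
    assume niso: "\<not> tt_isomorphic G H"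
    from lmr obtain \<epsilon> where H: "H \<in> tt_graphs n m" and \<epsilon>: "0 < \<epsilon>"
      and best: "\<And>p. p \<in> {0..1} \<inter> {-\<epsilon><..<\<epsilon>} \<Longrightarrow> reliability3 G p \<le> reliability3 H p"
      unfolding locally_most_reliable_near_0_def using G by blast
    define p where "p = min 1 (min \<delta> \<epsilon>) / 2"
    have "0 < p" "p < \<delta>" "p < \<epsilon>" "p \<le> 1" using \<delta> \<epsilon> by (auto simp: p_def)
    then show False using less[OF H, of p] dich[OF H] niso best[of p] by auto
  qed
  ultimately show ?thesis unfolding unique_locally_most_reliable_near_0_def by blast
qed

section \<open>Graphs described by their missing edges\<close>

definition missing :: "'a tt_graph \<Rightarrow> 'a set set" where
  "missing G = pairs (verts G) - edges G"

lemma edges_eq_pairs_minus_missing: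
  "simple_tt_graph G \<Longrightarrow> edges G = pairs (verts G) - missing G"
  using simple_edges_pairs unfolding missing_def by blast

lemma tt_isomorphic_if_missing:
  assumes G: "simple_tt_graph G" and H: "simple_tt_graph H"
    and f: "bij_betw f (verts G) (verts H)" and fT: "f ` targets G = targets H"
    and miss: "(`) f ` missing G = missing H"
  shows "tt_isomorphic G H"
proof -
  have bij: "bij_betw ((`) f) (pairs (verts G)) (pairs (verts H))"
    by (rule bij_betw_image_pairs[OF f])
  have inj: "inj_on f (verts G)" using f by (simp add: bij_betw_def)
  have ED: "(`) f ` edges G = edges H"
  proof -
    have "(`) f ` edges G = (`) f ` pairs (verts G) - (`) f ` missing G"
      unfolding edges_eq_pairs_minus_missing[OF G]
      by (rule inj_on_image_set_diff[of _ "pairs (verts G)"]) (use bij in \<open>auto simp: bij_betw_def missing_def\<close>)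
    then show ?thesis using edges_eq_pairs_minus_missing[OF H] miss bij by (simp add: bij_betw_def)
  qed
  have "{u, w} \<in> edges G \<longleftrightarrow> {f u, f w} \<in> edges H" if "u \<in> verts G" "w \<in> verts G" for u w
  proof -
    have "edges G \<subseteq> Pow (verts G)" using simple_edges_pairs[OF G] pairs_subset_Pow by blast
    then have "f ` {u, w} \<in> (`) f ` edges G \<longleftrightarrow> {u, w} \<in> edges G"
      using that by (intro inj_on_image_mem_iff[OF inj_on_image_Pow_subset[OF inj, of "Pow (verts G)"]]) auto
    then show ?thesis using ED by simp
  qed
  then show ?thesis unfolding tt_isomorphic_def using f fT by blast
qed

text \<open>
  One statement serves both for isomorphisms between two graphs and, with \<open>V = V'\<close>, for symmetries of
  the complete graph: up to such maps only the shape of a set of missing edges matters.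
\<close>
lemma bij_betw_prescribed:
  assumes fin: "finite V" "finite V'" and T: "T \<subseteq> V" "T' \<subseteq> V'"
    and card: "card V = card V'" "card T = card T'"
    and xs: "distinct xs" "set xs \<subseteq> V - T" and ys: "distinct ys" "set ys \<subseteq> V' - T'"
    and len: "length xs = length ys"
  obtains f where "bij_betw f V V'" "f ` T = T'" "map f xs = ys"
proof -
  define g where "g x = ys ! inv_into {..<length xs} ((!) xs) x" for x
  have xs_bij: "bij_betw ((!) xs) {..<length xs} (set xs)" using xs(1) by (simp add: bij_betw_nth)
  have g_nth: "g (xs ! i) = ys ! i" if "i < length xs" for i
    using that xs_bij by (simp add: g_def bij_betw_def)
  then have g_map: "map g xs = ys" by (intro nth_equalityI) (auto simp: len)
  then have g: "bij_betw g (set xs) (set ys)"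
    using ys(1) by (metis bij_betw_def distinct_map set_map)
  obtain h where h: "bij_betw h T T'"
    using finite_same_card_bij[of T T'] card(2) T fin finite_subset by metis
  have "card (V - T - set xs) = card (V' - T' - set ys)"
  proof -
    have "card (V - T - set xs) = card V - card T - card (set xs)"
      using xs T fin by (simp add: card_Diff_subset finite_subset)
    moreover have "card (V' - T' - set ys) = card V' - card T' - card (set ys)"
      using ys T fin by (simp add: card_Diff_subset finite_subset)
    ultimately show ?thesis using card len xs ys by (simp add: distinct_card)
  qed
  then obtain k where k: "bij_betw k (V - T - set xs) (V' - T' - set ys)"
    using finite_same_card_bij fin by (metis finite_Diff)
  define f where "f x = (if x \<in> T then h x else if x \<in> set xs then g x else k x)" for x
  have fT: "bij_betw f T T'"
    using h by (subst bij_betw_cong[of T f h]) (auto simp: f_def)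
  have fxs: "bij_betw f (set xs) (set ys)"
    using g xs by (subst bij_betw_cong[of _ f g]) (auto simp: f_def)
  have fk: "bij_betw f (V - T - set xs) (V' - T' - set ys)"
    using k by (subst bij_betw_cong[of _ f k]) (auto simp: f_def)
  have "bij_betw f (T \<union> (set xs \<union> (V - T - set xs))) (T' \<union> (set ys \<union> (V' - T' - set ys)))"
    by (rule bij_betw_combine[OF fT bij_betw_combine[OF fxs fk]]) (use ys in auto)
  moreover have "T \<union> (set xs \<union> (V - T - set xs)) = V" "T' \<union> (set ys \<union> (V' - T' - set ys)) = V'"
    using T xs ys by auto
  ultimately have "bij_betw f V V'" by simp
  moreover have "f ` T = T'" using fT by (simp add: bij_betw_def)
  moreover have "map f xs = map g xs"
    using xs(2) by (auto simp: f_def intro!: map_cong)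
  ultimately show thesis using that g_map by metis
qed

text \<open>
  A competitor has its own vertices; moving the optimum onto them lets both edge sets be compared as
  subsets of the same complete graph.
\<close>
lemma obtain_isomorphic_copy:
  assumes G: "simple_tt_graph G" and H: "simple_tt_graph H" and n: "card (verts G) = card (verts H)"
  obtains G' f where "simple_tt_graph G'" "verts G' = verts H" "targets G' = targets H"
    "tt_isomorphic G G'" "missing G' = (`) f ` missing G"
    "bij_betw f (verts G) (verts H)" "f ` targets G = targets H"
proof -
  have T3': "card (targets G) = card (targets H)"
    using G H by (simp add: simple_tt_graph_def targets_def)
  obtain f where f: "bij_betw f (verts G) (verts H)" "f ` targets G = targets H"
    using bij_betw_prescribed[of "verts G" "verts H" "targets G" "targets H" "[]" "[]"] n T3' G H
    by (auto simp: simple_tt_graph_def)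
  define G' where "G' = H\<lparr>edges := (`) f ` edges G\<rparr>"
  have bij: "bij_betw ((`) f) (pairs (verts G)) (pairs (verts H))"
    by (rule bij_betw_image_pairs[OF f(1)])
  have vs: "verts G' = verts H" "targets G' = targets H" "edges G' = (`) f ` edges G"
    by (auto simp: G'_def targets_def)
  have "(`) f ` edges G \<subseteq> pairs (verts H)"
    using simple_edges_pairs[OF G] bij by (auto simp: bij_betw_def)
  then have G': "simple_tt_graph G'"
    using H unfolding simple_tt_graph_def pairs_iff vs by (simp add: G'_def)
  have miss: "missing G' = (`) f ` missing G"
  proof -
    have "missing G' = (`) f ` pairs (verts G) - (`) f ` edges G"
      using bij by (simp add: missing_def vs bij_betw_def)
    also have "\<dots> = (`) f ` missing G"
      unfolding missing_def
      by (rule inj_on_image_set_diff[symmetric, of _ "pairs (verts G)"])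
        (use bij simple_edges_pairs[OF G] in \<open>auto simp: bij_betw_def\<close>)
    finally show ?thesis .
  qed
  have "tt_isomorphic G G'"
    by (rule tt_isomorphic_if_missing[OF G G', of f]) (use f vs miss in auto)
  then show thesis using that G' vs f miss by blast
qed

lemma card_missing:
  assumes "simple_tt_graph G"
  shows "card (missing G) = (card (verts G) choose 2) - card (edges G)"
  unfolding missing_def
  using assms simple_edges_pairs[OF assms] simple_finite_edges[OF assms]
    n_subsets[of "verts G" 2]
  by (simp add: card_Diff_subset pairs_def simple_tt_graph_def)

section \<open>Inclusion, exclusion and reachability\<close>

lemma inclusion_exclusion_avoiding:
  assumes "finite D" "finite \<F>"
  shows "int (card {F \<in> \<F>. F \<inter> D = {}}) = (\<Sum>X\<in>Pow D. (-1) ^ card X * int (card {F \<in> \<F>. X \<subseteq> F}))"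
  using assms
proof (induction D arbitrary: \<F> rule: finite_induct)
  case (insert d D)
  let ?A = "{F \<in> \<F>. F \<inter> D = {}}" and ?\<F>d = "{F \<in> \<F>. d \<in> F}"
  let ?s = "\<lambda>X. (-1) ^ card X * int (card {F \<in> \<F>. X \<subseteq> F})"
  have split: "{F \<in> \<F>. F \<inter> insert d D = {}} = ?A - {F \<in> ?\<F>d. F \<inter> D = {}}" by auto
  have "int (card {F \<in> \<F>. F \<inter> insert d D = {}}) = int (card ?A) - int (card {F \<in> ?\<F>d. F \<inter> D = {}})"
  proof -
    have sub: "{F \<in> ?\<F>d. F \<inter> D = {}} \<subseteq> ?A" by auto
    then have "card {F \<in> ?\<F>d. F \<inter> D = {}} \<le> card ?A" using insert.prems by (intro card_mono) auto
    then show ?thesis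
      unfolding split using insert.prems sub by (simp add: card_Diff_subset of_nat_diff)
  qed
  also have "\<dots> = (\<Sum>X\<in>Pow D. ?s X) - (\<Sum>X\<in>Pow D. (-1) ^ card X * int (card {F \<in> ?\<F>d. X \<subseteq> F}))"
    using insert.IH[of \<F>] insert.IH[of ?\<F>d] insert.prems by (simp del: mem_Collect_eq)
  also have "(\<Sum>X\<in>Pow D. (-1) ^ card X * int (card {F \<in> ?\<F>d. X \<subseteq> F})) = - (\<Sum>X\<in>Pow D. ?s (insert d X))"
    unfolding sum_negf[symmetric]
  proof (rule sum.cong)
    fix X assume "X \<in> Pow D"
    then have "card (insert d X) = Suc (card X)"
      using insert.hyps by (intro card_insert_disjoint) (auto dest: finite_subset)
    moreover have "{F \<in> ?\<F>d. X \<subseteq> F} = {F \<in> \<F>. insert d X \<subseteq> F}" by auto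
    ultimately show "(-1) ^ card X * int (card {F \<in> ?\<F>d. X \<subseteq> F}) = - ?s (insert d X)" by simp
  qed simp
  also have "(\<Sum>X\<in>Pow D. ?s (insert d X)) = (\<Sum>X\<in>insert d ` Pow D. ?s X)"
    using insert.hyps by (subst sum.reindex) (auto simp: inj_on_def)
  also have "(\<Sum>X\<in>Pow D. ?s X) - - (\<Sum>X\<in>insert d ` Pow D. ?s X) = (\<Sum>X\<in>Pow (insert d D). ?s X)"
    unfolding Pow_insert using insert.hyps by (subst sum.union_disjoint) auto
  finally show ?case .
qed simp

lemma reach_closed:
  assumes "(x, y) \<in> (adjacency F)\<^sup>*" "x \<in> S" "\<And>e. e \<in> F \<Longrightarrow> e \<subseteq> S \<or> e \<inter> S = {}"
  shows "y \<in> S"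
  using assms(1,2)
proof induction
  case (step y z)
  then show ?case using assms(3)[of "{y, z}"] by (auto simp: adjacency_def)
qed

lemma adjacency_mono: "F \<subseteq> F' \<Longrightarrow> adjacency F \<subseteq> adjacency F'"
  by (auto simp: adjacency_def)

lemma reach_mono: "(x, y) \<in> (adjacency F)\<^sup>* \<Longrightarrow> F \<subseteq> F' \<Longrightarrow> (x, y) \<in> (adjacency F')\<^sup>*"
  using rtrancl_mono[OF adjacency_mono] by blast

lemma reach_sym: "(x, y) \<in> (adjacency F)\<^sup>* \<Longrightarrow> (y, x) \<in> (adjacency F)\<^sup>*"
proof -
  have "sym (adjacency F)" by (auto simp: sym_def adjacency_def insert_commute)
  then show "(x, y) \<in> (adjacency F)\<^sup>* \<Longrightarrow> (y, x) \<in> (adjacency F)\<^sup>*"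
    using sym_rtrancl symD by metis
qed

lemma reach_edge: "{x, y} \<in> F \<Longrightarrow> (x, y) \<in> (adjacency F)\<^sup>*"
  by (auto simp: adjacency_def)

section \<open>Edges needed outside the inner part\<close>

locale terminals =
  fixes V T :: "'a set"
  assumes finV: "finite V" and TV: "T \<subseteq> V" and cardT: "card T = 3"
begin

text \<open>
  Edges that are not inner are called outer; they are the edges with an endpoint in \<open>T\<close>.
\<close>
definition inner :: "'a set set" where "inner = pairs (V - T)"

definition connects :: "'a set set \<Rightarrow> bool" where
  "connects F \<longleftrightarrow> (\<forall>x\<in>T. \<forall>y\<in>T. (x, y) \<in> (adjacency F)\<^sup>*)"

text \<open>
  Two edges between targets already connect everything, whatever else is present. Thin sets are the
  connecting sets without this trivial reason.
\<close>
definition thin :: "'a set set \<Rightarrow> bool" where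
  "thin F \<longleftrightarrow> connects F \<and> card (F \<inter> pairs T) \<le> 1"

definition linked :: "'a set set \<Rightarrow> 'a set \<Rightarrow> bool" where
  "linked X U \<longleftrightarrow> (\<forall>x\<in>U. \<forall>y\<in>U. (x, y) \<in> (adjacency X)\<^sup>*)"

lemma finT: "finite T" using finV TV finite_subset by blast
lemma fin_pairs: "finite (pairs V)" using finV by (rule finite_pairs)
lemma inner_sub: "inner \<subseteq> pairs V" by (auto simp: inner_def pairs_def)
lemma finite_inner_subset: "X \<subseteq> inner \<Longrightarrow> finite X"
  by (rule finite_subset[OF _ finite_subset[OF inner_sub fin_pairs]])
lemma pairsT_sub: "pairs T \<subseteq> pairs V" using TV by (auto simp: pairs_def)
lemma inner_pairsT: "inner \<inter> pairs T = {}"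
proof -
  have "e = {}" if "e \<in> inner \<inter> pairs T" for e
    using that by (auto simp: inner_def pairs_def)
  then show ?thesis by (force simp: pairs_def)
qed

lemma edge_cases:
  assumes "e \<in> pairs V"
  obtains "e \<in> inner" | "e \<in> pairs T" | a x where "a \<in> T" "x \<in> V - T" "e = {a, x}"
proof -
  obtain u w where uw: "e = {u, w}" "u \<in> V" "w \<in> V" "u \<noteq> w" using assms by (auto simp: pairs_iff)
  show thesis
    using that(1,2) that(3)[of u w] that(3)[of w u] uw unfolding inner_def pairs_iff
    by (cases "u \<in> T"; cases "w \<in> T") (auto simp: insert_commute)
qed

lemma connects_mono: "connects F \<Longrightarrow> F \<subseteq> F' \<Longrightarrow> connects F'"
  unfolding connects_def using reach_mono by metis

lemma not_connects_if_cut: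
  assumes "s \<in> S" "s \<in> T" "t \<in> T" "t \<notin> S" "\<And>e. e \<in> F \<Longrightarrow> e \<subseteq> S \<or> e \<inter> S = {}"
  shows "\<not> connects F"
  using reach_closed[of s t F S] assms unfolding connects_def by blast

text \<open>
  Here \<open>X\<close> is a union of components of the inner edges that is reached from the targets through \<open>e\<close>
  only, and hence useless. Among the other two outer edges, \<open>f\<close> touches only the target \<open>a\<close>. Then \<open>g\<close>
  cannot help: either it avoids one of the other two targets, which is isolated apart from \<open>e\<close>, or it
  joins exactly these two, and they are cut off from \<open>a\<close>. Taking \<open>X\<close> and \<open>e\<close> empty covers the case of
  two outer edges.
\<close>
lemma not_connects_if_few_outer:
  assumes outer: "F - inner \<subseteq> {e, f, g}" and X: "X \<subseteq> V - T"
    and closed: "\<And>d. d \<in> F \<inter> inner \<Longrightarrow> d \<subseteq> X \<or> d \<inter> X = {}"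
    and e: "e \<subseteq> insert c X" "c \<in> T" and f: "f \<inter> T \<subseteq> {a}" "a \<in> T" "f \<inter> X = {}"
    and g: "g \<inter> X = {}" "finite g" "card g \<le> 2"
  shows "\<not> connects F"
proof -
  have two: "card (T - {a}) = 2" using f(2) cardT finT by simp
  have ne: "T - {a} \<noteq> {}"
  proof
    assume "T - {a} = {}"
    then show False using two by (simp only: card.empty)
  qed
  have cut: "\<not> connects F"
    if A: "A \<subseteq> T - {a}" "A \<noteq> {}" "g \<subseteq> A \<or> g \<inter> A = {}" for A
  proof -
    \<comment> \<open>The part \<open>X\<close> hangs on \<open>c\<close> by \<open>e\<close>, so it goes to the side of the cut on which \<open>c\<close> lies.\<close>
    define S where "S = A \<union> (if c \<in> A then X else {})"
    obtain b where "b \<in> A" using A by blast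
    show ?thesis
    proof (rule not_connects_if_cut[of b S a])
      fix d assume d: "d \<in> F"
      show "d \<subseteq> S \<or> d \<inter> S = {}"
      proof (cases "d \<in> inner")
        case True
        then have "d \<inter> A = {}" using A by (auto simp: inner_def pairs_def)
        then show ?thesis using closed[of d] d True by (auto simp: S_def)
      next
        case False
        then consider "d = e" | "d = f" | "d = g" using d outer by blast
        then show ?thesis using A X e f g by cases (auto simp: S_def)
      qed
    qed (use \<open>b \<in> A\<close> A X f in \<open>auto simp: S_def\<close>)
  qed
  show ?thesis
  proof (cases "T - {a} \<subseteq> g")
    case True
    then have "g = T - {a}" using g two card_seteq[of g "T - {a}"] by simp
    then show ?thesis using ne by (intro cut[of "T - {a}"]) blast+
  next
    case False
    then obtain b where "b \<in> T - {a}" "b \<notin> g" by blast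
    then show ?thesis by (intro cut[of "{b}"]) auto
  qed
qed

text \<open>
  This is where the first differences of the counts come from: a thin set with \<open>i\<close> edges has at most
  \<open>i - 3\<close> inner edges.
\<close>
lemma thin_outer_ge_3:
  assumes F: "F \<subseteq> pairs V" "thin F"
  shows "3 \<le> card (F - inner)"
proof (rule ccontr)
  let ?P = "F - inner"
  assume "\<not> 3 \<le> card ?P"
  then have P2: "card ?P \<le> 2" by simp
  have finP: "finite ?P" using F(1) fin_pairs by (auto intro: finite_subset)
  obtain t0 where t0: "t0 \<in> T" using cardT by fastforce
  have "\<exists>f g a. ?P \<subseteq> {f, g} \<and> f \<inter> T \<subseteq> {a} \<and> a \<in> T \<and> finite g \<and> card g \<le> 2"
  proof (cases "?P \<subseteq> pairs T")
    case True
    then have "?P \<subseteq> F \<inter> pairs T" by blast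
    then have "card ?P \<le> 1"
      using F(2) finP card_mono[of "F \<inter> pairs T" ?P] F(1) fin_pairs finite_subset[of F]
      unfolding thin_def by fastforce
    then have "?P = {} \<or> (\<exists>g. ?P = {g})" using finP by (metis card_0_eq card_1_singletonE le_antisym less_one not_less)
    then consider "?P = {}" | g where "?P = {g}" by blast
    then show ?thesis
    proof cases
      case 1
      then have "?P \<subseteq> {{}, {}} \<and> {} \<inter> T \<subseteq> {t0} \<and> t0 \<in> T \<and> finite {} \<and> card {} \<le> 2"
        using t0 by auto
      then show ?thesis by blast
    next
      case 2
      then have "g \<in> pairs T" using True by blast
      then have "finite g \<and> card g \<le> 2" using finT by (auto simp: pairs_def finite_subset)
      then have "?P \<subseteq> {{}, g} \<and> {} \<inter> T \<subseteq> {t0} \<and> t0 \<in> T \<and> finite g \<and> card g \<le> 2"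
        using t0 2 by simp
      then show ?thesis by blast
    qed
  next
    case False
    then obtain f where f: "f \<in> ?P" "f \<notin> pairs T" by blast
    then obtain a x where ax: "a \<in> T" "x \<in> V - T" "f = {a, x}"
      using edge_cases[of f] F(1) by blast
    have "card (?P - {f}) \<le> 1" using P2 f finP by simp
    then have "?P - {f} = {} \<or> (\<exists>g. ?P - {f} = {g})"
      using finP by (metis card_0_eq card_1_singletonE finite_Diff le_antisym less_one not_less)
    then consider "?P \<subseteq> {f}" | g where "?P - {f} = {g}" by blast
    then show ?thesis
    proof cases
      case 1
      then have "?P \<subseteq> {f, {}} \<and> f \<inter> T \<subseteq> {a} \<and> a \<in> T \<and> finite {} \<and> card {} \<le> 2"
        using ax by auto
      then show ?thesis by blast
    next
      case 2
      then have "g \<in> pairs V" using F(1) by blast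
      then have "finite g \<and> card g \<le> 2" using finV by (auto simp: pairs_def finite_subset)
      moreover have "?P \<subseteq> {f, g}" using 2 by blast
      ultimately have "?P \<subseteq> {f, g} \<and> f \<inter> T \<subseteq> {a} \<and> a \<in> T \<and> finite g \<and> card g \<le> 2"
        using ax by auto
      then show ?thesis by blast
    qed
  qed
  then obtain f g a where "?P \<subseteq> {f, g}" "f \<inter> T \<subseteq> {a}" "a \<in> T" "finite g" "card g \<le> 2" by blast
  then have "\<not> connects F"
    using t0 by (intro not_connects_if_few_outer[of F "{}" f g "{}" t0 a]) auto
  then show False using F(2) by (simp add: thin_def)
qed

text \<open>
  The extremal thin sets that contain \<open>X\<close>: those in which \<open>X\<close> is completed by exactly three outer
  edges and no further inner edge.
\<close>
definition links :: "'a set set \<Rightarrow> 'a set set set" where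
  "links X = {Z. Z \<subseteq> pairs V - inner \<and> card Z = 3 \<and> thin (Z \<union> X)}"

lemma thin_union_inner:
  assumes "X \<subseteq> inner" shows "thin (Z \<union> X) \<longleftrightarrow> connects (Z \<union> X) \<and> card (Z \<inter> pairs T) \<le> 1"
proof -
  have "(Z \<union> X) \<inter> pairs T = Z \<inter> pairs T" using assms inner_pairsT by blast
  then show ?thesis by (simp add: thin_def)
qed

lemma outer_edge_one:
  assumes "d \<in> pairs V - inner" "x \<in> d" "y \<in> d" "x \<notin> T" "y \<notin> T" shows "x = y"
  using edge_cases[of d] assms by (auto simp: pairs_def)

text \<open>
  The edges \<open>X\<close> matter only through their components. If the endpoints of \<open>Z\<close> outside \<open>T\<close> lie in one
  component, contracting all vertices outside \<open>T\<close> or only this component makes no difference. If they do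
  not, one component or the rest is touched by only one of the three edges of \<open>Z\<close>, and
  \<open>not_connects_if_few_outer\<close> applies.
\<close>
lemma links_iff:
  assumes X: "X \<subseteq> inner"
  shows "Z \<in> links X \<longleftrightarrow> Z \<in> links inner \<and> linked X (\<Union>Z - T)"
proof
  assume Z: "Z \<in> links X"
  then have Zo: "Z \<subseteq> pairs V - inner" and Z3: "card Z = 3" and con: "connects (Z \<union> X)"
    and t1: "card (Z \<inter> pairs T) \<le> 1"
    by (auto simp: links_def thin_union_inner[OF X])
  have "connects (Z \<union> inner)" by (rule connects_mono[OF con]) (use X in auto)
  then have "Z \<in> links inner" using Zo Z3 t1 by (simp add: links_def thin_union_inner)
  moreover have "linked X (\<Union>Z - T)"
    unfolding linked_def
  proof (intro ballI, rule ccontr)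
    fix x y assume x: "x \<in> \<Union>Z - T" and y: "y \<in> \<Union>Z - T" and nxy: "(x, y) \<notin> (adjacency X)\<^sup>*"
    \<comment> \<open>The component of \<open>x\<close>. The third edge \<open>g\<close> has at most one endpoint outside \<open>T\<close>, so it misses
      either \<open>C\<close> or the remaining vertices outside \<open>T\<close>.\<close>
    define C where "C = {w \<in> V - T. (x, w) \<in> (adjacency X)\<^sup>*}"
    have closed: "d \<subseteq> C \<or> d \<inter> C = {}" if d: "d \<in> X" for d
    proof -
      obtain u w where uw: "d = {u, w}" "u \<in> V - T" "w \<in> V - T"
        using d X by (auto simp: inner_def pairs_iff)
      then have "(u, w) \<in> (adjacency X)\<^sup>*" "(w, u) \<in> (adjacency X)\<^sup>*"
        using d reach_edge[of u w X] reach_edge[of w u X] by (auto simp: insert_commute)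
      then have "u \<in> C \<longleftrightarrow> w \<in> C" using uw unfolding C_def by (auto intro: rtrancl_trans)
      then show ?thesis using uw by auto
    qed
    obtain ex ey where e: "ex \<in> Z" "x \<in> ex" "ey \<in> Z" "y \<in> ey" using x y by blast
    then have eV: "ex \<in> pairs V - inner" "ey \<in> pairs V - inner" using Zo by auto
    then have xyV: "x \<in> V - T" "y \<in> V - T" using e x y by (auto simp: pairs_def)
    then have xC: "x \<in> C" and yC: "y \<notin> C" using nxy by (auto simp: C_def)
    obtain a where a: "a \<in> T" "ex = {a, x}"
      using edge_cases[of ex] eV e(2) x by (auto simp: pairs_def)
    obtain b where b: "b \<in> T" "ey = {b, y}"
      using edge_cases[of ey] eV e(4) y by (auto simp: pairs_def)
    have "ex \<noteq> ey" using a b xC yC xyV by auto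
    then have "card (Z - {ex, ey}) = 1" using e Z3 by (simp add: card_Diff_subset)
    then obtain g where g: "Z - {ex, ey} = {g}" by (auto simp: card_1_singleton_iff)
    then have ZZ: "Z = {ex, ey, g}" using e by auto
    have gV: "g \<in> pairs V - inner" using g Zo by blast
    then have gf: "finite g" "card g \<le> 2" by (auto simp: pairs_def intro: card_ge_0_finite)
    have outer: "Z \<union> X - inner \<subseteq> {ex, ey, g}" using ZZ X by auto
    have inX: "(Z \<union> X) \<inter> inner \<subseteq> X" using Zo by auto
    have CV: "C \<subseteq> V - T" by (auto simp: C_def)
    show False
    proof (cases "g \<inter> C = {}")
      case True
      have "\<not> connects (Z \<union> X)"
        by (rule not_connects_if_few_outer[OF outer, of C a b])
          (use True CV a b xC yC xyV gf closed inX in auto)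
      then show False using con by simp
    next
      case False
      let ?C = "V - T - C"
      have gC: "g \<inter> ?C = {}"
        using False gV CV outer_edge_one[OF gV] by blast
      have closed': "d \<subseteq> ?C \<or> d \<inter> ?C = {}" if d: "d \<in> X" for d
      proof -
        have "d \<subseteq> V - T" using d X by (auto simp: inner_def pairs_def)
        then show ?thesis using closed[OF d] by blast
      qed
      have outer': "Z \<union> X - inner \<subseteq> {ey, ex, g}" using outer by blast
      have "\<not> connects (Z \<union> X)"
        by (rule not_connects_if_few_outer[OF outer', of ?C b a])
          (use gC CV a b xC yC xyV gf closed' inX in auto)
      then show False using con by simp
    qed
  qed
  ultimately show "Z \<in> links inner \<and> linked X (\<Union>Z - T)" by blast
next
  assume Z: "Z \<in> links inner \<and> linked X (\<Union>Z - T)"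
  then have Zo: "Z \<subseteq> pairs V - inner" and Z3: "card Z = 3" and con: "connects (Z \<union> inner)"
    and t1: "card (Z \<inter> pairs T) \<le> 1" and lk: "linked X (\<Union>Z - T)"
    by (auto simp: links_def thin_union_inner)
  have "connects (Z \<union> X)"
    unfolding connects_def
  proof (intro ballI)
    fix s t assume s: "s \<in> T" and t: "t \<in> T"
    \<comment> \<open>\<open>S'\<close> treats all vertices outside \<open>T\<close> as reached as soon as one of
      them that \<open>Z\<close> touches is reached; it is closed under
      the inner edges, and on \<open>T\<close> it agrees with \<open>S\<close>.\<close>
    define S where "S = {y. (s, y) \<in> (adjacency (Z \<union> X))\<^sup>*}"
    define S' where "S' = (S \<inter> T) \<union> (if S \<inter> (\<Union>Z - T) = {} then {} else V - T)"
    have adj: "y \<in> S" if "x \<in> S" "{x, y} \<in> Z" for x y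
      using that reach_edge[of x y "Z \<union> X"] by (auto simp: S_def intro: rtrancl_trans)
    have lkS: "y \<in> S" if "x \<in> S" "x \<in> \<Union>Z - T" "y \<in> \<Union>Z - T" for x y
    proof -
      have "(x, y) \<in> (adjacency (Z \<union> X))\<^sup>*"
        using that lk reach_mono[of x y X "Z \<union> X"] by (auto simp: linked_def)
      then show ?thesis using that(1) by (auto simp: S_def intro: rtrancl_trans)
    qed
    have "t \<in> S'"
    proof (rule reach_closed[of s t "Z \<union> inner"])
      show "(s, t) \<in> (adjacency (Z \<union> inner))\<^sup>*" using con s t by (simp add: connects_def)
      show "s \<in> S'" using s by (simp add: S'_def S_def)
      fix d assume d: "d \<in> Z \<union> inner"
      show "d \<subseteq> S' \<or> d \<inter> S' = {}"
      proof (cases "d \<in> inner")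
        case True
        then show ?thesis by (auto simp: S'_def inner_def pairs_def)
      next
        case False
        then have dZ: "d \<in> Z" using d by simp
        then have "d \<in> pairs V" using Zo by auto
        then consider "d \<in> pairs T" | a x where "a \<in> T" "x \<in> V - T" "d = {a, x}"
          using False edge_cases[of d] by metis
        then show ?thesis
        proof cases
          case 1
          then obtain u w where uw: "d = {u, w}" "u \<in> T" "w \<in> T" by (auto simp: pairs_iff)
          then have "u \<in> S \<longleftrightarrow> w \<in> S" using adj[of u w] adj[of w u] dZ by (auto simp: insert_commute)
          then show ?thesis using uw by (auto simp: S'_def)
        next
          case 2
          then have xU: "x \<in> \<Union>Z - T" using dZ by auto
          have "a \<in> S \<longleftrightarrow> x \<in> S" using adj[of a x] adj[of x a] dZ 2 by (auto simp: insert_commute)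
          moreover have "x \<in> S \<longleftrightarrow> S \<inter> (\<Union>Z - T) \<noteq> {}" using xU lkS by blast
          ultimately show ?thesis using 2 by (auto simp: S'_def)
        qed
      qed
    qed
    then show "(s, t) \<in> (adjacency (Z \<union> X))\<^sup>*" using t by (auto simp: S'_def S_def split: if_splits)
  qed
  then show "Z \<in> links X" using Zo Z3 t1 X by (simp add: links_def thin_union_inner)
qed

section \<open>Counting connecting edge sets\<close>

definition thin_above :: "nat \<Rightarrow> 'a set set \<Rightarrow> nat" where
  "thin_above i X = card {F. F \<subseteq> pairs V \<and> X \<subseteq> F \<and> card F = i \<and> thin F}"

definition thin_avoiding :: "nat \<Rightarrow> 'a set set \<Rightarrow> nat" where
  "thin_avoiding i D = card {F. F \<subseteq> pairs V - D \<and> card F = i \<and> thin F}"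

definition thick_avoiding :: "nat \<Rightarrow> 'a set set \<Rightarrow> nat" where
  "thick_avoiding i D = card {F. F \<subseteq> pairs V - D \<and> card F = i \<and> 2 \<le> card (F \<inter> pairs T)}"

definition connecting_avoiding :: "nat \<Rightarrow> 'a set set \<Rightarrow> nat" where
  "connecting_avoiding i D = card {F. F \<subseteq> pairs V - D \<and> card F = i \<and> connects F}"

lemma connects_if_thick:
  assumes "2 \<le> card (F \<inter> pairs T)" shows "connects F"
proof -
  obtain d e where de: "d \<in> F" "d \<in> pairs T" "e \<in> F" "e \<in> pairs T" "d \<noteq> e"
    using assms by (metis (no_types, lifting) IntD1 IntD2 card_le_Suc0_iff_eq card.infinite
        not_less_eq_eq numeral_2_eq_2 zero_le)
  obtain a b where ab: "d = {a, b}" "a \<in> T" "b \<in> T" "a \<noteq> b" using de(2) by (auto simp: pairs_iff)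
  have "card (T - {a, b}) = 1" using ab cardT finT by (simp add: card_Diff_subset)
  then obtain c where c: "T - {a, b} = {c}" by (auto simp: card_1_singleton_iff)
  then have Tabc: "T = {a, b, c}" "c \<noteq> a" "c \<noteq> b" using ab by auto
  have "e = {a, c} \<or> e = {b, c}"
    using de(4,5) ab(1) unfolding pairs_iff Tabc(1) by (auto simp: insert_commute)
  then have "(a, c) \<in> (adjacency F)\<^sup>*"
    using de(1,3) ab(1) reach_edge[of a b F] reach_edge[of b c F] reach_edge[of a c F]
    by (auto intro: rtrancl_trans)
  moreover have "(a, b) \<in> (adjacency F)\<^sup>*" using de(1) ab(1) reach_edge by simp
  ultimately have "(a, y) \<in> (adjacency F)\<^sup>*" if "y \<in> T" for y using that Tabc(1) by auto
  then show ?thesis unfolding connects_def by (meson reach_sym rtrancl_trans)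
qed

lemma connecting_avoiding_split:
  "connecting_avoiding i D = thick_avoiding i D + thin_avoiding i D"
proof -
  let ?A = "{F. F \<subseteq> pairs V - D \<and> card F = i \<and> 2 \<le> card (F \<inter> pairs T)}"
  let ?B = "{F. F \<subseteq> pairs V - D \<and> card F = i \<and> thin F}"
  have "{F. F \<subseteq> pairs V - D \<and> card F = i \<and> connects F} = ?A \<union> ?B"
    using connects_if_thick by (auto simp: thin_def)
  moreover have "?A \<inter> ?B = {}" by (auto simp: thin_def)
  moreover have "finite ?A" "finite ?B"
    by (rule finite_subset[of _ "Pow (pairs V)"]; use fin_pairs in auto)+
  ultimately show ?thesis
    unfolding connecting_avoiding_def thick_avoiding_def thin_avoiding_def
    by (simp add: card_Un_disjoint)
qed

text \<open>
  Whether a set contains two edges between targets is decided by \<open>pairs T\<close> alone, so the remaining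
  edges may be exchanged by an arbitrary bijection of edges.
\<close>
lemma thick_avoiding_cong:
  assumes "D \<subseteq> pairs V - pairs T" "D' \<subseteq> pairs V - pairs T" "card D = card D'"
  shows "thick_avoiding i D = thick_avoiding i D'"
proof -
  have fD: "finite D" "finite D'" using assms fin_pairs by (auto intro: finite_subset)
  have "card (pairs V - pairs T - D) = card (pairs V - pairs T - D')"
    using assms fD by (simp add: card_Diff_subset)
  then obtain h where h: "bij_betw h (pairs V - pairs T - D) (pairs V - pairs T - D')"
    using finite_same_card_bij fin_pairs by (metis finite_Diff)
  define k where "k e = (if e \<in> pairs T then e else h e)" for e
  have k1: "bij_betw k (pairs T) (pairs T)"
    by (subst bij_betw_cong[of _ _ id]) (auto simp: k_def)
  have k2: "bij_betw k (pairs V - pairs T - D) (pairs V - pairs T - D')"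
    using h by (subst bij_betw_cong[of _ _ h]) (auto simp: k_def)
  have "bij_betw k (pairs T \<union> (pairs V - pairs T - D)) (pairs T \<union> (pairs V - pairs T - D'))"
    using k1 k2 by (rule bij_betw_combine) auto
  moreover have "pairs T \<union> (pairs V - pairs T - D) = pairs V - D"
    "pairs T \<union> (pairs V - pairs T - D') = pairs V - D'"
    using assms pairsT_sub by auto
  ultimately have k: "bij_betw k (pairs V - D) (pairs V - D')" by simp
  then have inj: "inj_on k (pairs V - D)" by (simp add: bij_betw_def)
  have kT: "k ` F \<inter> pairs T = F \<inter> pairs T" if "F \<subseteq> pairs V - D" for F
  proof -
    have "k e \<notin> pairs T" if "e \<in> F" "e \<notin> pairs T" for e
      using that \<open>F \<subseteq> pairs V - D\<close> h by (auto simp: k_def bij_betw_def)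
    moreover have "k e = e" if "e \<in> pairs T" for e using that by (simp add: k_def)
    ultimately show ?thesis by force
  qed
  show ?thesis
    unfolding thick_avoiding_def
    by (rule card_family_image[OF k]) (simp add: kT card_image_subset[OF inj])
qed

lemma thin_avoiding_inclusion_exclusion:
  assumes "finite D"
  shows "int (thin_avoiding i D) = (\<Sum>X\<in>Pow D. (-1) ^ card X * int (thin_above i X))"
proof -
  let ?\<F> = "{F. F \<subseteq> pairs V \<and> card F = i \<and> thin F}"
  have "finite ?\<F>" by (rule finite_subset[of _ "Pow (pairs V)"]) (use fin_pairs in auto)
  moreover have "{F. F \<subseteq> pairs V - D \<and> card F = i \<and> thin F} = {F \<in> ?\<F>. F \<inter> D = {}}" by auto
  moreover have "{F. F \<subseteq> pairs V \<and> X \<subseteq> F \<and> card F = i \<and> thin F} = {F \<in> ?\<F>. X \<subseteq> F}" for X by auto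
  ultimately show ?thesis
    using inclusion_exclusion_avoiding[OF assms, of ?\<F>]
    unfolding thin_avoiding_def thin_above_def by (simp only:)
qed

text \<open>
  A permutation of the vertices that preserves \<open>T\<close> is a symmetry of the complete graph, so the number
  of thin sets above \<open>X\<close> depends only on the shape of \<open>X\<close>.
\<close>
lemma thin_above_image:
  assumes \<pi>: "bij_betw \<pi> V V" "\<pi> ` T = T" and X: "X \<subseteq> pairs V"
  shows "thin_above i ((`) \<pi> ` X) = thin_above i X"
proof -
  have inj: "inj_on \<pi> V" using \<pi> by (simp add: bij_betw_def)
  have bij: "bij_betw ((`) \<pi>) (pairs V) (pairs V)" using \<pi>(1) by (rule bij_betw_image_pairs)
  then have injP: "inj_on ((`) \<pi>) (pairs V)" by (simp add: bij_betw_def)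
  have "thin F \<longleftrightarrow> thin ((`) \<pi> ` F)" if F: "F \<subseteq> pairs V" for F
  proof -
    have FP: "F \<subseteq> Pow V" using F pairs_subset_Pow by blast
    have "connects ((`) \<pi> ` F) \<longleftrightarrow> (\<forall>x\<in>\<pi> ` T. \<forall>y\<in>\<pi> ` T. (x, y) \<in> (adjacency ((`) \<pi> ` F))\<^sup>*)"
      by (simp add: connects_def \<pi>(2))
    also have "\<dots> \<longleftrightarrow> (\<forall>x\<in>T. \<forall>y\<in>T. (\<pi> x, \<pi> y) \<in> (adjacency ((`) \<pi> ` F))\<^sup>*)" by simp
    also have "\<dots> \<longleftrightarrow> connects F"
      unfolding connects_def using reach_image_iff[OF inj FP] TV by (meson subsetD)
    finally have "connects ((`) \<pi> ` F) \<longleftrightarrow> connects F" .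
    moreover have "card ((`) \<pi> ` F \<inter> pairs T) = card (F \<inter> pairs T)"
    proof -
      have "bij_betw \<pi> T T" by (rule bij_betw_subset[OF \<pi>(1) TV \<pi>(2)])
      then have "(`) \<pi> ` pairs T = pairs T"
        by (rule bij_betw_imp_surj_on[OF bij_betw_image_pairs])
      then have "(`) \<pi> ` F \<inter> pairs T = (`) \<pi> ` (F \<inter> pairs T)"
        using inj_on_image_Int[OF injP F pairsT_sub] by simp
      then show ?thesis using F by (simp add: card_image_subset[OF injP] le_infI1)
    qed
    ultimately show ?thesis by (simp add: thin_def)
  qed
  moreover have "X \<subseteq> F \<longleftrightarrow> (`) \<pi> ` X \<subseteq> (`) \<pi> ` F" if "F \<subseteq> pairs V" for F
    using inj_on_image_subset_iff[OF injP X that] by simp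
  moreover have "card ((`) \<pi> ` F) = card F" if "F \<subseteq> pairs V" for F
    using that by (rule card_image_subset[OF injP])
  ultimately show ?thesis
    unfolding thin_above_def by (intro card_family_image[OF bij, symmetric]) simp
qed

lemma obtain_symmetry:
  assumes "distinct xs" "distinct ys" "set xs \<subseteq> V - T" "set ys \<subseteq> V - T" "length xs = length ys"
  obtains \<pi> where "bij_betw \<pi> V V" "\<pi> ` T = T" "map \<pi> xs = ys"
  using bij_betw_prescribed[of V V T T xs ys] assms finV TV by blast

lemma thin_above_eq_0:
  assumes X: "X \<subseteq> inner" and i: "i < card X + 3"
  shows "thin_above i X = 0"
proof -
  have "card F \<noteq> i" if F: "F \<subseteq> pairs V" "X \<subseteq> F" "thin F" for F
  proof -
    have fF: "finite F" using F(1) fin_pairs finite_subset by blast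
    have "card X + card (F - inner) = card (X \<union> (F - inner))"
      using fF F(2) X by (subst card_Un_disjoint) (auto intro: finite_subset)
    also have "\<dots> \<le> card F" using F(2) fF by (intro card_mono) auto
    finally show ?thesis using thin_outer_ge_3[OF F(1,3)] i by linarith
  qed
  then have "{F. F \<subseteq> pairs V \<and> X \<subseteq> F \<and> card F = i \<and> thin F} = {}" by blast
  then show ?thesis by (simp only: thin_above_def card.empty)
qed

lemma finite_links: "finite (links X)"
  unfolding links_def by (rule finite_subset[of _ "Pow (pairs V)"]) (use fin_pairs in auto)

lemma thin_above_links:
  assumes X: "X \<subseteq> inner"
  shows "thin_above (card X + 3) X = card (links X)"
proof -
  have fX: "finite X" using X by (rule finite_inner_subset)
  have "(\<lambda>Z. Z \<union> X) ` links X = {F. F \<subseteq> pairs V \<and> X \<subseteq> F \<and> card F = card X + 3 \<and> thin F}"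
  proof (intro equalityI subsetI)
    fix F assume "F \<in> (\<lambda>Z. Z \<union> X) ` links X"
    then obtain Z where Z: "F = Z \<union> X" "Z \<subseteq> pairs V - inner" "card Z = 3" "thin F"
      by (auto simp: links_def)
    then have "card F = card X + 3"
      using X fX fin_pairs by (subst Z(1), subst card_Un_disjoint) (auto intro: finite_subset)
    then show "F \<in> {F. F \<subseteq> pairs V \<and> X \<subseteq> F \<and> card F = card X + 3 \<and> thin F}"
      using Z X inner_sub by auto
  next
    fix F assume "F \<in> {F. F \<subseteq> pairs V \<and> X \<subseteq> F \<and> card F = card X + 3 \<and> thin F}"
    then have F: "F \<subseteq> pairs V" "X \<subseteq> F" "card F = card X + 3" "thin F" by auto
    have fF: "finite F" using F(1) fin_pairs finite_subset by blast
    have c: "card (X \<union> (F - inner)) = card X + card (F - inner)"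
      using fF fX X by (subst card_Un_disjoint) auto
    have "F - inner \<union> X = F"
    proof (rule card_seteq[OF fF])
      show "card F \<le> card (F - inner \<union> X)"
        using c thin_outer_ge_3[OF F(1,4)] F(3) by (simp add: Un_commute)
    qed (use F in auto)
    moreover from this have "card (F - inner) = 3" using c F(3) by (simp add: Un_commute)
    ultimately have "F - inner \<in> links X" using F by (auto simp: links_def)
    then show "F \<in> (\<lambda>Z. Z \<union> X) ` links X"
      using \<open>F - inner \<union> X = F\<close> by (metis image_eqI)
  qed
  moreover have "inj_on (\<lambda>Z. Z \<union> X) (links X)"
  proof (rule inj_onI)
    fix Z Z' assume Z: "Z \<in> links X" "Z' \<in> links X" "Z \<union> X = Z' \<union> X"
    have "Z \<inter> inner = {}" "Z' \<inter> inner = {}" using Z by (auto simp: links_def)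
    then show "Z = Z'" using Z(3) X by blast
  qed
  ultimately show ?thesis
    unfolding thin_above_def by (metis card_image)
qed

lemma card_links_image:
  assumes \<pi>: "bij_betw \<pi> V V" "\<pi> ` T = T" and X: "X \<subseteq> inner" "(`) \<pi> ` X \<subseteq> inner"
  shows "card (links ((`) \<pi> ` X)) = card (links X)"
proof -
  have XV: "X \<subseteq> pairs V" using X(1) inner_sub by (rule order_trans)
  have "inj_on ((`) \<pi>) (pairs V)"
    using bij_betw_image_pairs[OF \<pi>(1)] by (simp add: bij_betw_def)
  then have c: "card ((`) \<pi> ` X) = card X" using XV by (rule card_image_subset)
  show ?thesis
    using thin_above_links[OF X(2)] unfolding c thin_above_image[OF \<pi> XV] thin_above_links[OF X(1)]
    by (rule sym)
qed

lemma links_mono: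
  assumes "X \<subseteq> inner" "X' \<subseteq> inner" "\<And>e. e \<in> X \<Longrightarrow> linked X' e"
  shows "links X \<subseteq> links X'"
proof -
  have "adjacency X \<subseteq> (adjacency X')\<^sup>*"
  proof (rule subrelI)
    fix x y assume "(x, y) \<in> adjacency X"
    then have "{x, y} \<in> X" by (simp add: adjacency_def)
    then have "linked X' {x, y}" by (rule assms(3))
    then show "(x, y) \<in> (adjacency X')\<^sup>*" by (simp add: linked_def)
  qed
  then have "(adjacency X)\<^sup>* \<subseteq> (adjacency X')\<^sup>*" by (rule rtrancl_subset_rtrancl)
  then have "linked X U \<Longrightarrow> linked X' U" for U unfolding linked_def by blast
  then show ?thesis by (simp add: subset_iff links_iff[OF assms(1)] links_iff[OF assms(2)])
qed

section \<open>Comparing small patterns of inner edges\<close>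

lemma linked_closed:
  assumes "linked X U" "x \<in> U" "y \<in> U" "x \<in> S" "\<And>e. e \<in> X \<Longrightarrow> e \<subseteq> S \<or> e \<inter> S = {}"
  shows "y \<in> S"
proof (rule reach_closed[OF _ assms(4,5)])
  show "(x, y) \<in> (adjacency X)\<^sup>*" using assms(1-3) by (simp add: linked_def)
qed

text \<open>
  Every pair of vertices outside \<open>T\<close> is relevant: some \<open>Z\<close> has exactly these endpoints. This makes the
  comparisons below strict.
\<close>
lemma obtain_link:
  assumes ab: "a \<in> V - T" "b \<in> V - T" "a \<noteq> b"
  obtains Z where "Z \<in> links inner" "\<Union>Z - T = {a, b}"
proof -
  obtain r s t where T: "T = {r, s, t}" "r \<noteq> s" "s \<noteq> t" "r \<noteq> t" using cardT unfolding card_3_iff by blast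
  let ?Z = "{{r, s}, {r, a}, {t, b}}"
  have nab: "a \<notin> {r, s, t}" "b \<notin> {r, s, t}" using ab T by auto
  have out: "?Z \<subseteq> pairs V - inner" using ab T TV unfolding inner_def pairs_iff by auto
  have c3: "card ?Z = 3" using nab T(2-4) ab(3) by (auto simp: doubleton_eq_iff)
  have pT: "?Z \<inter> pairs T \<subseteq> {{r, s}}" using nab unfolding pairs_def T(1) by auto
  then have "card (?Z \<inter> pairs T) \<le> 1" using card_mono[OF _ pT] by simp
  moreover have "connects (?Z \<union> inner)"
  proof -
    let ?R = "(adjacency (?Z \<union> inner))\<^sup>*"
    have "{a, b} \<in> inner" using ab unfolding inner_def pairs_iff by blast
    have e: "(r, s) \<in> ?R" "(r, a) \<in> ?R" "(a, b) \<in> ?R" "(b, t) \<in> ?R"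
      by (rule reach_edge, use \<open>{a, b} \<in> inner\<close> in \<open>simp add: insert_commute\<close>)+
    have "(r, t) \<in> ?R"
      by (rule rtrancl_trans[OF e(2) rtrancl_trans[OF e(3) e(4)]])
    then have "(r, y) \<in> ?R" if "y \<in> T" for y using that e T(1) by auto
    then show ?thesis unfolding connects_def by (meson reach_sym rtrancl_trans)
  qed
  ultimately have "?Z \<in> links inner" using out c3 by (simp add: links_def thin_union_inner)
  moreover have "\<Union>?Z - T = {a, b}" using nab T by auto
  ultimately show thesis by (rule that)
qed

text \<open>
  For disjoint edges \<open>{a, b}\<close> and \<open>{c, d}\<close>, what is linked by both together is linked by one of them. For a
  path, the links of the two edges have only the links of the empty pattern in common, which are
  common links in the other case as well. By symmetry all single edges have equally many links, so
  the union is at least as large for the path, and in addition the path links its two ends.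
\<close>
lemma card_links_path_gt_matching:
  assumes path: "x \<in> V - T" "y \<in> V - T" "z \<in> V - T" "distinct [x, y, z]"
    and match: "a \<in> V - T" "b \<in> V - T" "c \<in> V - T" "d \<in> V - T" "distinct [a, b, c, d]"
  shows "card (links {{a, b}, {c, d}}) < card (links {{x, y}, {y, z}})"
proof -
  have sing: "{{u, w}} \<subseteq> inner" if "u \<in> V - T" "w \<in> V - T" "u \<noteq> w" for u w
    using that unfolding inner_def pairs_iff by blast
  have in2: "{{a, b}, {c, d}} \<subseteq> inner" "{{x, y}, {y, z}} \<subseteq> inner"
    using sing path match by auto
  have one: "card (links {{u, w}}) = card (links {{a, b}})"
    if uw: "u \<in> V - T" "w \<in> V - T" "u \<noteq> w" for u w
  proof -
    obtain \<pi> where "bij_betw \<pi> V V" "\<pi> ` T = T" "map \<pi> [a, b] = [u, w]"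
      by (rule obtain_symmetry[of "[a, b]" "[u, w]"]) (use uw match in auto)
    then show ?thesis using card_links_image[of \<pi> "{{a, b}}"] sing uw match by simp
  qed
  have empty: "links {} \<subseteq> links X" if "X \<subseteq> inner" for X using that by (intro links_mono) auto
  have mat: "links {{a, b}, {c, d}} \<subseteq> links {{a, b}} \<union> links {{c, d}}"
  proof
    fix Z assume "Z \<in> links {{a, b}, {c, d}}"
    then have Z: "Z \<in> links inner" and lk: "linked {{a, b}, {c, d}} (\<Union>Z - T)"
      using links_iff[OF in2(1)] by auto
    have "linked {{a, b}} (\<Union>Z - T) \<or> linked {{c, d}} (\<Union>Z - T)"
    proof -
      have 1: "w = u" if "u \<in> \<Union>Z - T" "w \<in> \<Union>Z - T" "u \<notin> {a, b, c, d}" for u w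
        using linked_closed[OF lk that(1,2), of "{u}"] that by auto
      have 2: "w \<in> {a, b}" if "u \<in> \<Union>Z - T" "w \<in> \<Union>Z - T" "u \<in> {a, b}" for u w
        by (rule linked_closed[OF lk that(1,2)]) (use that match in auto)
      have 3: "w \<in> {c, d}" if "u \<in> \<Union>Z - T" "w \<in> \<Union>Z - T" "u \<in> {c, d}" for u w
        by (rule linked_closed[OF lk that(1,2)]) (use that match in auto)
      have ab: "(a, b) \<in> (adjacency {{a, b}})\<^sup>*" "(b, a) \<in> (adjacency {{a, b}})\<^sup>*"
        "(c, d) \<in> (adjacency {{c, d}})\<^sup>*" "(d, c) \<in> (adjacency {{c, d}})\<^sup>*"
        by (auto intro!: reach_edge simp: insert_commute)
      show ?thesis
      proof (cases "\<exists>u\<in>\<Union>Z - T. u \<in> {c, d}")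
        case True
        then have "\<Union>Z - T \<subseteq> {c, d}" using 3 by blast
        then have "linked {{c, d}} (\<Union>Z - T)" using ab unfolding linked_def by blast
        then show ?thesis ..
      next
        case False
        then have "(u, w) \<in> (adjacency {{a, b}})\<^sup>*" if "u \<in> \<Union>Z - T" "w \<in> \<Union>Z - T" for u w
          using 1[of u w] 2[of u w] that ab by blast
        then show ?thesis unfolding linked_def by blast
      qed
    qed
    then show "Z \<in> links {{a, b}} \<union> links {{c, d}}"
      using Z links_iff[of "{{a, b}}" Z] links_iff[of "{{c, d}}" Z] sing match by auto
  qed
  have pat: "links {{x, y}} \<inter> links {{y, z}} \<subseteq> links {}"
  proof
    fix Z assume "Z \<in> links {{x, y}} \<inter> links {{y, z}}"
    then have Z: "Z \<in> links inner" and lk: "linked {{x, y}} (\<Union>Z - T)" "linked {{y, z}} (\<Union>Z - T)"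
      using links_iff[of "{{x, y}}" Z] links_iff[of "{{y, z}}" Z] sing path by auto
    have "u = w" if "u \<in> \<Union>Z - T" "w \<in> \<Union>Z - T" for u w
    proof (cases "u \<in> {y, z}")
      case True
      have "w \<in> {y, z}" by (rule linked_closed[OF lk(2) that True]) auto
      moreover have "u \<in> {z} \<Longrightarrow> w \<in> {z}"
        by (rule linked_closed[OF lk(1) that]) (use path in auto)
      moreover have "w \<in> {z} \<Longrightarrow> u \<in> {z}"
        by (rule linked_closed[OF lk(1) that(2,1)]) (use path in auto)
      ultimately show ?thesis using True by blast
    next
      case False
      have "w \<in> {u}" by (rule linked_closed[OF lk(2) that]) (use False in auto)
      then show ?thesis by simp
    qed
    then have "linked {} (\<Union>Z - T)" unfolding linked_def by blast
    then show "Z \<in> links {}" using Z links_iff[of "{}" Z] by auto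
  qed
  have lkxyz: "linked {{x, y}, {y, z}} {x, z}"
  proof -
    have "(x, y) \<in> (adjacency {{x, y}, {y, z}})\<^sup>*" "(y, z) \<in> (adjacency {{x, y}, {y, z}})\<^sup>*"
      by (auto intro!: reach_edge)
    then have "(x, z) \<in> (adjacency {{x, y}, {y, z}})\<^sup>*" by (rule rtrancl_trans)
    then show ?thesis using reach_sym[of x z] by (simp add: linked_def)
  qed
  obtain Z where Z: "Z \<in> links inner" "\<Union>Z - T = {x, z}" 
    by (rule obtain_link[of x z]) (use path in auto)
  have Zin: "Z \<in> links {{x, y}, {y, z}}" using Z lkxyz links_iff[OF in2(2)] by simp
  have "\<not> linked {{x, y}} {x, z}"
    by (rule notI, drule linked_closed[where x = z and y = x and S = "{z}"]) (use path in auto)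
  moreover have "\<not> linked {{y, z}} {x, z}"
    by (rule notI, drule linked_closed[where x = x and y = z and S = "{x}"]) (use path in auto)
  ultimately have Zout: "Z \<notin> links {{x, y}} \<union> links {{y, z}}"
    using Z links_iff[of "{{x, y}}" Z] links_iff[of "{{y, z}}" Z] sing path by auto
  have sub: "links {{x, y}} \<union> links {{y, z}} \<subseteq> links {{x, y}, {y, z}}"
    using links_mono[of "{{x, y}}" "{{x, y}, {y, z}}"] links_mono[of "{{y, z}}" "{{x, y}, {y, z}}"]
      sing path in2 by (auto simp: linked_def intro!: reach_edge simp: insert_commute)
  have "card (links {{a, b}, {c, d}}) \<le> card (links {{a, b}} \<union> links {{c, d}})"
    using mat finite_links by (intro card_mono) auto
  also have "\<dots> + card (links {{a, b}} \<inter> links {{c, d}}) = card (links {{a, b}}) + card (links {{c, d}})"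
    using card_Un_Int[OF finite_links finite_links] by simp
  also have "\<dots> = card (links {{x, y}}) + card (links {{y, z}})"
    using one[of x y] one[of y z] one[of c d] path match by simp
  also have "\<dots> = card (links {{x, y}} \<union> links {{y, z}}) + card (links {{x, y}} \<inter> links {{y, z}})"
    by (rule card_Un_Int[OF finite_links finite_links])
  also have "\<dots> \<le> card (links {{x, y}} \<union> links {{y, z}}) + card (links {{a, b}} \<inter> links {{c, d}})"
  proof (rule add_left_mono, rule card_mono)
    have "links {} \<subseteq> links {{a, b}} \<inter> links {{c, d}}" using empty sing match by auto
    then show "links {{x, y}} \<inter> links {{y, z}} \<subseteq> links {{a, b}} \<inter> links {{c, d}}" using pat by blast
  qed (use finite_links in auto)
  finally have "card (links {{a, b}, {c, d}}) \<le> card (links {{x, y}} \<union> links {{y, z}})" by simp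
  also have "\<dots> < card (links {{x, y}, {y, z}})"
    by (rule psubset_card_mono[OF finite_links]) (use sub Zin Zout in blast)
  finally show ?thesis .
qed

text \<open>
  By symmetry the triangle may be placed on the centre \<open>u\<close> and two leaves of the star. The star then
  connects all three vertices of the triangle and the leaf \<open>z\<close> in addition.
\<close>
lemma card_links_triangle_lt_star:
  assumes tri: "a \<in> V - T" "b \<in> V - T" "c \<in> V - T" "distinct [a, b, c]"
    and star: "u \<in> V - T" "x \<in> V - T" "y \<in> V - T" "z \<in> V - T" "distinct [u, x, y, z]"
  shows "card (links {{a, b}, {a, c}, {b, c}}) < card (links {{u, x}, {u, y}, {u, z}})"
proof -
  let ?S = "{{u, x}, {u, y}, {u, z}}" and ?D = "{{u, x}, {u, y}, {x, y}}"
  have in1: "{{a, b}, {a, c}, {b, c}} \<subseteq> inner" "?S \<subseteq> inner" "?D \<subseteq> inner"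
    using tri star unfolding inner_def pairs_iff by auto
  obtain \<pi> where "bij_betw \<pi> V V" "\<pi> ` T = T" "map \<pi> [a, b, c] = [u, x, y]"
    by (rule obtain_symmetry[of "[a, b, c]" "[u, x, y]"]) (use tri star in auto)
  then have "card (links ?D) = card (links {{a, b}, {a, c}, {b, c}})"
    using card_links_image[of \<pi> "{{a, b}, {a, c}, {b, c}}"] in1 by simp
  moreover have "links ?D \<subset> links ?S"
  proof
    show "links ?D \<subseteq> links ?S"
    proof (rule links_mono[OF in1(3,2)])
      have ux: "(u, w) \<in> (adjacency ?S)\<^sup>*" if "w \<in> {u, x, y, z}" for w
        using that by (cases "w = u") (auto intro!: reach_edge)
      have "(v, w) \<in> (adjacency ?S)\<^sup>*" if "v \<in> {u, x, y, z}" "w \<in> {u, x, y, z}" for v w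
        using ux[OF that(2)] reach_sym[OF ux[OF that(1)]] by (rule rtrancl_trans[rotated])
      then show "linked ?S e" if "e \<in> ?D" for e using that unfolding linked_def by blast
    qed
    obtain Z where Z: "Z \<in> links inner" "\<Union>Z - T = {u, z}" 
      by (rule obtain_link[of u z]) (use star in auto)
    have "linked ?S {u, z}"
      using reach_edge[of u z ?S] reach_edge[of z u ?S] by (simp add: linked_def insert_commute)
    then have "Z \<in> links ?S" using Z links_iff[OF in1(2)] by simp
    moreover have "\<not> linked ?D {u, z}"
      by (rule notI, drule linked_closed[where x = z and y = u and S = "{z}"]) (use star in auto)
    then have "Z \<notin> links ?D" using Z links_iff[OF in1(3)] by simp
    ultimately show "links ?D \<noteq> links ?S" by blast
  qed
  ultimately show ?thesis using psubset_card_mono[OF finite_links] by metis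
qed

end

section \<open>Families of pairwise meeting edges\<close>

definition pairwise_meeting :: "'a set set \<Rightarrow> bool" where
  "pairwise_meeting D \<longleftrightarrow> (\<forall>d\<in>D. \<forall>e\<in>D. d \<inter> e \<noteq> {})"

lemma obtain_path:
  assumes "d \<in> pairs S" "e \<in> pairs S" "d \<noteq> e" "d \<inter> e \<noteq> {}"
  obtains x y z where "x \<in> S" "y \<in> S" "z \<in> S" "distinct [x, y, z]" "d = {x, y}" "e = {y, z}"
proof -
  obtain y where y: "y \<in> d" "y \<in> e" using assms(4) by blast
  obtain x where x: "d = {x, y}" "x \<noteq> y"
    using assms(1) y(1) unfolding pairs_iff by (auto simp: insert_commute)
  obtain z where z: "e = {y, z}" "y \<noteq> z"
    using assms(2) y(2) unfolding pairs_iff by (auto simp: insert_commute)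
  have "x \<noteq> z" using x(1) z(1) assms(3) by (auto simp: insert_commute)
  moreover have "x \<in> S" "y \<in> S" "z \<in> S" using assms(1,2) x z by (auto simp: pairs_def)
  ultimately show thesis using that[of x y z] x z by simp
qed

text \<open>
  Two of the edges form a path \<open>b - a - c\<close>. An edge that avoids \<open>a\<close> must be \<open>{b, c}\<close>, and then every edge
  meets all three sides of the triangle \<open>a b c\<close>, which leaves only these sides.
\<close>
lemma pairwise_meeting_cases:
  assumes D: "D \<subseteq> pairs S" "pairwise_meeting D" "2 \<le> card D"
  obtains (star) c L where "c \<in> S" "L \<subseteq> S - {c}" "D = (\<lambda>x. {c, x}) ` L"
  | (triangle) a b c where "a \<in> S" "b \<in> S" "c \<in> S" "distinct [a, b, c]" "D = {{a, b}, {a, c}, {b, c}}"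
proof -
  have meet: "d \<inter> e \<noteq> {}" if "d \<in> D" "e \<in> D" for d e
    using D(2) that unfolding pairwise_meeting_def by blast
  have "\<not> card D \<le> Suc 0" using D(3) by simp
  moreover have "finite D" using D(3) by (auto intro: card_ge_0_finite)
  ultimately obtain d e where de: "d \<in> D" "e \<in> D" "d \<noteq> e" using card_le_Suc0_iff_eq by blast
  obtain b a c where abc: "a \<in> S" "b \<in> S" "c \<in> S" "distinct [b, a, c]" "d = {b, a}" "e = {a, c}"
    by (rule obtain_path[of d S e]) (use D(1) de meet[OF de(1,2)] in auto)
  show thesis
  proof (cases "\<forall>f\<in>D. a \<in> f")
    case True
    have "D = (\<lambda>x. {a, x}) ` {x \<in> S - {a}. {a, x} \<in> D}"
    proof (intro equalityI subsetI)
      fix f assume f: "f \<in> D"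
      then obtain u w where uw: "f = {u, w}" "u \<in> S" "w \<in> S" "u \<noteq> w" using D(1) unfolding pairs_iff by blast
      then consider "a = u" | "a = w" using True f by auto
      then show "f \<in> (\<lambda>x. {a, x}) ` {x \<in> S - {a}. {a, x} \<in> D}"
      proof cases
        case 1 then show ?thesis using f uw by (intro image_eqI[of _ _ w]) auto
      next
        case 2 then show ?thesis using f uw by (intro image_eqI[of _ _ u]) (auto simp: insert_commute)
      qed
    qed auto
    then show thesis by (intro star[of a "{x \<in> S - {a}. {a, x} \<in> D}"]) (use abc in auto)
  next
    case False
    then obtain f where f: "f \<in> D" "a \<notin> f" by blast
    have "b \<in> f" "c \<in> f" using meet[of f d] meet[of f e] f de abc by auto
    moreover obtain u w where "f = {u, w}" using f(1) D(1) unfolding pairs_iff by blast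
    ultimately have fbc: "f = {b, c}" using abc by auto
    have "g \<in> {{a, b}, {a, c}, {b, c}}" if g: "g \<in> D" for g
    proof -
      obtain u w where uw: "g = {u, w}" "u \<noteq> w" using g D(1) unfolding pairs_iff by blast
      have "g \<inter> {a, b} \<noteq> {}" "g \<inter> {a, c} \<noteq> {}" "g \<inter> {b, c} \<noteq> {}"
        using meet[of g d] meet[of g e] meet[of g f] g de f abc fbc by (auto simp: insert_commute)
      then have "u \<in> {a, b, c} \<and> w \<in> {a, b, c}" unfolding uw(1) using abc(4) by auto
      then show ?thesis using uw by (auto simp: insert_commute)
    qed
    then have "D = {{a, b}, {a, c}, {b, c}}" using de f abc fbc by (auto simp: insert_commute)
    then show thesis using triangle[of a b c] abc by auto
  qed
qed

section \<open>The first difference between two sets of missing edges\<close>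

lemma card_pairs_3:
  assumes "finite S" "card S = 3" shows "card (pairs S) = 3"
  using n_subsets[OF assms(1), of 2] assms(2) by (simp add: pairs_def numeral_3_eq_3 numeral_2_eq_2)

lemma lex_lessI:
  assumes "\<And>i. i < k \<Longrightarrow> a i \<le> b i" "a k < b k" shows "lex_less a b"
  using assms unfolding lex_less_def by blast

context terminals
begin

lemma finite_family: "finite {F. F \<subseteq> pairs V - D \<and> P F}"
  by (rule finite_subset[of _ "Pow (pairs V)"]) (use fin_pairs in auto)

text \<open>
  Connecting sets of at most two edges consist of edges between targets, which the deletion of \<open>D0\<close>
  does not affect. Each edge between targets lies in such a set.
\<close>
lemma lex_less_if_target_edge_missing:
  assumes D: "D \<inter> pairs T \<noteq> {}" and D0: "D0 \<subseteq> inner"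
  shows "lex_less (\<lambda>i. connecting_avoiding i D) (\<lambda>i. connecting_avoiding i D0)"
proof -
  let ?\<F> = "\<lambda>i D. {F. F \<subseteq> pairs V - D \<and> card F = i \<and> connects F}"
  have sub: "?\<F> i D \<subseteq> ?\<F> i D0" if i: "i \<le> 2" for i
  proof
    fix F assume F: "F \<in> ?\<F> i D"
    then have fF: "finite F" using fin_pairs by (auto intro: finite_subset)
    have "card (F - inner) \<le> card F" using fF by (intro card_mono) auto
    then have "\<not> thin F" using thin_outer_ge_3[of F] F i by auto
    then have "card F \<le> card (F \<inter> pairs T)" using F i by (simp add: thin_def)
    then have "F \<inter> pairs T = F" using fF by (intro card_seteq) auto
    then have "F \<inter> D0 = {}" using D0 inner_pairsT by blast
    then show "F \<in> ?\<F> i D0" using F by blast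
  qed
  obtain d where d: "d \<in> D" "d \<in> pairs T" using D by blast
  have "card (pairs T - {d}) = 2" using d(2) card_pairs_3[OF finT cardT] finite_pairs[OF finT] by simp
  then obtain e where e: "e \<in> pairs T" "e \<noteq> d" by (metis Diff_iff all_not_in_conv card.empty insertI1 zero_neq_numeral)
  have "{d, e} \<inter> pairs T = {d, e}" using d e by blast
  then have "connects {d, e}" using e by (intro connects_if_thick) simp
  moreover have "{d, e} \<subseteq> pairs V - D0" using d(2) e(1) pairsT_sub D0 inner_pairsT by blast
  ultimately have "{d, e} \<in> ?\<F> 2 D0" using e by simp
  moreover have "{d, e} \<notin> ?\<F> 2 D" using d by blast
  ultimately have ne: "?\<F> 2 D \<noteq> ?\<F> 2 D0" by metis
  have "?\<F> 2 D \<subset> ?\<F> 2 D0" by (rule psubsetI[OF sub ne]) simp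
  then have "connecting_avoiding 2 D < connecting_avoiding 2 D0"
    unfolding connecting_avoiding_def by (intro psubset_card_mono finite_family)
  moreover have "connecting_avoiding i D \<le> connecting_avoiding i D0" if "i < 2" for i
    unfolding connecting_avoiding_def using sub[of i] that by (intro card_mono finite_family) auto
  ultimately show ?thesis by (rule lex_lessI[rotated])
qed

text \<open>
  Thin sets of at most three edges have no inner edges, so they survive the deletion of \<open>D0\<close>, whereas
  \<open>D\<close> destroys at least one of them.
\<close>
lemma lex_less_if_target_incident_edge_missing:
  assumes D: "D \<subseteq> pairs V" "D \<inter> pairs T = {}" "\<not> D \<subseteq> inner"
    and D0: "D0 \<subseteq> inner" and card: "card D = card D0"
  shows "lex_less (\<lambda>i. connecting_avoiding i D) (\<lambda>i. connecting_avoiding i D0)"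
proof -
  let ?\<F> = "\<lambda>i D. {F. F \<subseteq> pairs V - D \<and> card F = i \<and> thin F}"
  have thick: "thick_avoiding i D = thick_avoiding i D0" for i
    using D D0 inner_sub inner_pairsT card by (intro thick_avoiding_cong) blast+
  have sub: "?\<F> i D \<subseteq> ?\<F> i D0" if i: "i \<le> 3" for i
  proof
    fix F assume F: "F \<in> ?\<F> i D"
    then have fF: "finite F" using fin_pairs by (auto intro: finite_subset)
    have FV: "F \<subseteq> pairs V" "thin F" "card F = i" using F by auto
    have "card F \<le> card (F - inner)" using thin_outer_ge_3[OF FV(1,2)] FV(3) i by linarith
    then have "F - inner = F" using fF by (intro card_seteq) auto
    then have "F \<inter> D0 = {}" using D0 by blast
    then show "F \<in> ?\<F> i D0" using F by blast
  qed
  obtain d where d: "d \<in> D" "d \<notin> inner" using D(3) by blast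
  then obtain a w where aw: "a \<in> T" "w \<in> V - T" "d = {a, w}"
    using edge_cases[of d] D(1,2) by blast
  have "card (T - {a}) = 2" using aw(1) cardT finT by simp
  then obtain b c where bc: "T - {a} = {b, c}" "b \<noteq> c" by (auto simp: card_2_iff)
  have T: "T = {a, b, c}" "a \<noteq> b" "a \<noteq> c" using bc aw(1) by auto
  have w: "w \<in> V" "w \<noteq> a" "w \<noteq> b" "w \<noteq> c" using aw(2) T(1) by auto
  \<comment> \<open>A thin set through the missing edge: \<open>a - w - b - c\<close>.\<close>
  let ?F = "{{a, w}, {b, w}, {b, c}}"
  have c3: "card ?F = 3" using w T bc(2) by (auto simp: doubleton_eq_iff)
  have "?F \<inter> inner = {}" using T(1) unfolding inner_def pairs_def by auto
  moreover have "?F \<subseteq> pairs V" using w T bc(2) TV unfolding pairs_def by auto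
  ultimately have out: "?F \<subseteq> pairs V - D0" using D0 by blast
  have pT: "?F \<inter> pairs T \<subseteq> {{b, c}}" using aw(2) unfolding pairs_def by auto
  have "card (?F \<inter> pairs T) \<le> 1" using card_mono[OF _ pT] by simp
  moreover have "connects ?F"
  proof -
    have e: "(b, w) \<in> (adjacency ?F)\<^sup>*" "(w, a) \<in> (adjacency ?F)\<^sup>*" "(b, c) \<in> (adjacency ?F)\<^sup>*"
      by (rule reach_edge, simp add: insert_commute)+
    have "(b, a) \<in> (adjacency ?F)\<^sup>*" by (rule rtrancl_trans[OF e(1,2)])
    then have "(b, y) \<in> (adjacency ?F)\<^sup>*" if "y \<in> T" for y using that e(3) T(1) by auto
    then show ?thesis unfolding connects_def by (meson reach_sym rtrancl_trans)
  qed
  ultimately have "?F \<in> ?\<F> 3 D0" using c3 out by (simp add: thin_def)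
  moreover have "?F \<notin> ?\<F> 3 D" using d(1) aw(3) by blast
  ultimately have ne: "?\<F> 3 D \<noteq> ?\<F> 3 D0" by metis
  have "?\<F> 3 D \<subset> ?\<F> 3 D0" by (rule psubsetI[OF sub ne]) simp
  then have "thin_avoiding 3 D < thin_avoiding 3 D0"
    unfolding thin_avoiding_def by (intro psubset_card_mono finite_family)
  then have "connecting_avoiding 3 D < connecting_avoiding 3 D0"
    by (simp add: connecting_avoiding_split thick)
  moreover have "connecting_avoiding i D \<le> connecting_avoiding i D0" if "i < 3" for i
  proof -
    have "thin_avoiding i D \<le> thin_avoiding i D0"
      unfolding thin_avoiding_def using sub[of i] that by (intro card_mono finite_family) auto
    then show ?thesis by (simp add: connecting_avoiding_split thick)
  qed
  ultimately show ?thesis by (rule lex_lessI[rotated])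
qed

text \<open>
  A bijection between the sets of missing edges matches the terms of the two alternating sums, which
  are then compared one by one.
\<close>
lemma connecting_avoiding_le:
  assumes D: "D \<subseteq> inner" "D0 \<subseteq> inner" and h: "bij_betw h D D0"
    and le: "\<And>X. X \<subseteq> D \<Longrightarrow>
      (-1) ^ card X * int (thin_above i X) \<le> (-1) ^ card X * int (thin_above i (h ` X))"
  shows "connecting_avoiding i D \<le> connecting_avoiding i D0"
    and "X \<subseteq> D \<Longrightarrow>
      (-1) ^ card X * int (thin_above i X) < (-1) ^ card X * int (thin_above i (h ` X)) \<Longrightarrow>
      connecting_avoiding i D < connecting_avoiding i D0"
proof -
  have fD: "finite D" "finite D0" using D finite_inner_subset by auto
  have thick: "thick_avoiding i D = thick_avoiding i D0"
    using D inner_sub inner_pairsT bij_betw_same_card[OF h] by (intro thick_avoiding_cong) blast+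
  have "(\<Sum>X\<in>Pow D. (-1) ^ card (h ` X) * int (thin_above i (h ` X)))
      = (\<Sum>X\<in>Pow D0. (-1) ^ card X * int (thin_above i X))"
    by (rule sum.reindex_bij_betw[OF bij_betw_Pow[OF h]])
  moreover have "card (h ` X) = card X" if "X \<subseteq> D" for X
    using h that card_image_subset unfolding bij_betw_def by blast
  ultimately have D0sum: "int (thin_avoiding i D0)
      = (\<Sum>X\<in>Pow D. (-1) ^ card X * int (thin_above i (h ` X)))"
    using thin_avoiding_inclusion_exclusion[OF fD(2), of i] by simp
  have "int (thin_avoiding i D) \<le> int (thin_avoiding i D0)"
    unfolding D0sum thin_avoiding_inclusion_exclusion[OF fD(1)] using le by (intro sum_mono) auto
  then show "connecting_avoiding i D \<le> connecting_avoiding i D0"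
    by (simp add: connecting_avoiding_split thick)
  assume X: "X \<subseteq> D"
    "(-1) ^ card X * int (thin_above i X) < (-1) ^ card X * int (thin_above i (h ` X))"
  have "int (thin_avoiding i D) < int (thin_avoiding i D0)"
    unfolding D0sum thin_avoiding_inclusion_exclusion[OF fD(1)]
    by (rule sum_strict_mono_ex1) (use fD le X in auto)
  then show "connecting_avoiding i D < connecting_avoiding i D0"
    by (simp add: connecting_avoiding_split thick)
qed

lemma thin_above_eq_card_le_1:
  assumes X: "X \<subseteq> inner" "X' \<subseteq> inner" "card X = card X'" "card X \<le> 1"
  shows "thin_above i X = thin_above i X'"
proof (cases "X = {}")
  case True
  then have "X' = {}" using X(2,3) finite_inner_subset by fastforce
  with True show ?thesis by simp
next
  case False
  then have "card X \<noteq> 0" using finite_inner_subset[OF X(1)] by simp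
  then have "card X = 1" "card X' = 1" using X(3,4) by auto
  then obtain d d' where d: "X = {d}" "X' = {d'}" by (auto simp: card_1_singleton_iff)
  then have "d \<in> pairs (V - T)" "d' \<in> pairs (V - T)" using X by (auto simp: inner_def)
  then obtain a b a' b' where ab: "d = {a, b}" "a \<in> V - T" "b \<in> V - T" "a \<noteq> b"
    "d' = {a', b'}" "a' \<in> V - T" "b' \<in> V - T" "a' \<noteq> b'"
    unfolding pairs_iff by blast
  obtain \<pi> where \<pi>: "bij_betw \<pi> V V" "\<pi> ` T = T" "map \<pi> [a, b] = [a', b']"
    by (rule obtain_symmetry[of "[a, b]" "[a', b']"]) (use ab in auto)
  have im: "X' = (`) \<pi> ` X" using d ab \<pi>(3) by simp
  have "X \<subseteq> pairs V" using X(1) inner_sub by blast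
  then show ?thesis unfolding im by (rule thin_above_image[OF \<pi>(1,2), symmetric])
qed

text \<open>
  Any two paths of two edges are exchanged by a symmetry.
\<close>
lemma thin_above_eq_path:
  assumes "d \<in> inner" "e \<in> inner" "d \<noteq> e" "d \<inter> e \<noteq> {}"
    and "d' \<in> inner" "e' \<in> inner" "d' \<noteq> e'" "d' \<inter> e' \<noteq> {}"
  shows "thin_above i {d, e} = thin_above i {d', e'}"
proof -
  obtain x y z where p: "x \<in> V - T" "y \<in> V - T" "z \<in> V - T" "distinct [x, y, z]" "d = {x, y}" "e = {y, z}"
    by (rule obtain_path[of d "V - T" e]) (use assms in \<open>auto simp: inner_def\<close>)
  obtain x' y' z' where p': "x' \<in> V - T" "y' \<in> V - T" "z' \<in> V - T" "distinct [x', y', z']"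
    "d' = {x', y'}" "e' = {y', z'}"
    by (rule obtain_path[of d' "V - T" e']) (use assms in \<open>auto simp: inner_def\<close>)
  obtain \<pi> where \<pi>: "bij_betw \<pi> V V" "\<pi> ` T = T" "map \<pi> [x, y, z] = [x', y', z']"
    by (rule obtain_symmetry[of "[x, y, z]" "[x', y', z']"]) (use p p' in auto)
  have im: "{d', e'} = (`) \<pi> ` {d, e}" using p p' \<pi>(3) by simp
  have "{d, e} \<subseteq> pairs V" using assms(1,2) inner_sub by blast
  then show ?thesis unfolding im by (rule thin_above_image[OF \<pi>(1,2), symmetric])
qed

lemma links_less_if_disjoint:
  assumes "d \<in> inner" "e \<in> inner" "d \<inter> e = {}"
    and "d' \<in> inner" "e' \<in> inner" "d' \<noteq> e'" "d' \<inter> e' \<noteq> {}"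
  shows "card (links {d, e}) < card (links {d', e'})"
proof -
  obtain x y z where p: "x \<in> V - T" "y \<in> V - T" "z \<in> V - T" "distinct [x, y, z]" "d' = {x, y}" "e' = {y, z}"
    by (rule obtain_path[of d' "V - T" e']) (use assms in \<open>auto simp: inner_def\<close>)
  have "d \<in> pairs (V - T)" "e \<in> pairs (V - T)" using assms by (auto simp: inner_def)
  then obtain a b u w where ab: "d = {a, b}" "a \<in> V - T" "b \<in> V - T" "a \<noteq> b"
    "e = {u, w}" "u \<in> V - T" "w \<in> V - T" "u \<noteq> w"
    unfolding pairs_iff by blast
  then have "distinct [a, b, u, w]" using assms(3) by auto
  then show ?thesis unfolding ab(1,5) p(5,6)
    using card_links_path_gt_matching[of x y z a b u w] p ab by blast
qed

lemma obtain_two_elements: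
  assumes "card X = 2" obtains d e where "X = {d, e}" "d \<noteq> e"
  using assms by (auto simp: card_2_iff)

lemma thin_above_eq_meeting:
  assumes D: "D \<subseteq> inner" "D0 \<subseteq> inner" and h: "bij_betw h D D0"
    and meet: "pairwise_meeting D" "pairwise_meeting D0" and X: "X \<subseteq> D" "card X \<le> 2"
  shows "thin_above i X = thin_above i (h ` X)"
proof -
  have inj: "inj_on h D" and im: "h ` D = D0" using h by (auto simp: bij_betw_def)
  have XI: "X \<subseteq> inner" "h ` X \<subseteq> inner" using X(1) D im by auto
  show ?thesis
  proof (cases "card X \<le> 1")
    case True
    then show ?thesis using XI card_image_subset[OF inj X(1)] by (intro thin_above_eq_card_le_1) auto
  next
    case False
    then have "card X = 2" using X(2) by simp
    then obtain d e where de: "X = {d, e}" "d \<noteq> e" by (rule obtain_two_elements)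
    have "h d \<noteq> h e" using de X(1) inj by (auto simp: inj_on_def)
    moreover have "h d \<in> D0" "h e \<in> D0" "d \<in> D" "e \<in> D" using de(1) X(1) im by auto
    ultimately have "thin_above i {d, e} = thin_above i {h d, h e}"
      using de D meet unfolding pairwise_meeting_def by (intro thin_above_eq_path) auto
    then show ?thesis by (simp add: de(1))
  qed
qed

text \<open>
  For \<open>i \<le> 4\<close> only the terms with \<open>card X \<le> 1\<close> can be nonzero, and these agree by symmetry. At \<open>i = 5\<close> the pairs \<open>X\<close> enter, with a positive sign, and a disjoint pair contributes less than
  a path.
\<close>
lemma lex_less_if_disjoint_missing_edges:
  assumes D: "D \<subseteq> inner" "\<not> pairwise_meeting D"
    and D0: "D0 \<subseteq> inner" "pairwise_meeting D0" and card: "card D = card D0"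
  shows "lex_less (\<lambda>i. connecting_avoiding i D) (\<lambda>i. connecting_avoiding i D0)"
proof -
  obtain h where h: "bij_betw h D D0"
    using finite_same_card_bij[OF finite_inner_subset finite_inner_subset card] D(1) D0(1) by blast
  have inj: "inj_on h D" and im: "h ` D = D0" using h by (auto simp: bij_betw_def)
  have XI: "X \<subseteq> inner" "h ` X \<subseteq> inner" "card (h ` X) = card X" if "X \<subseteq> D" for X
    using that D(1) D0(1) im card_image_subset[OF inj that] by auto
  have pair: "h d \<in> inner" "h e \<in> inner" "h d \<noteq> h e" "h d \<inter> h e \<noteq> {}" "d \<in> inner" "e \<in> inner"
    if "d \<in> D" "e \<in> D" "d \<noteq> e" for d e
  proof -
    have "h d \<in> D0" "h e \<in> D0" using that im by auto
    then show "h d \<in> inner" "h e \<in> inner" "h d \<inter> h e \<noteq> {}"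
      using D0 unfolding pairwise_meeting_def by auto
    show "h d \<noteq> h e" using that inj by (auto simp: inj_on_def)
    show "d \<in> inner" "e \<in> inner" using that D(1) by auto
  qed
  have strict: "thin_above 5 {d, e} < thin_above 5 (h ` {d, e})"
    if de: "d \<in> D" "e \<in> D" "d \<noteq> e" "d \<inter> e = {}" for d e
  proof -
    note p = pair[OF de(1-3)]
    have "card (links {d, e}) < card (links {h d, h e})"
      using links_less_if_disjoint p de(4) by blast
    then show ?thesis
      using thin_above_links[of "{d, e}"] thin_above_links[of "{h d, h e}"] p de(3) by simp
  qed
  have eq: "thin_above i X = thin_above i (h ` X)" if X: "X \<subseteq> D" "card X \<noteq> 2 \<or> i < 5" "i \<le> 5" for i X
  proof (cases "card X \<le> 1")
    case True
    then show ?thesis using XI[OF X(1)] by (intro thin_above_eq_card_le_1) auto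
  next
    case False
    then have "i < card X + 3" using X by linarith
    then show ?thesis using XI[OF X(1)] by (simp add: thin_above_eq_0)
  qed
  have le5: "(-1) ^ card X * int (thin_above 5 X) \<le> (-1) ^ card X * int (thin_above 5 (h ` X))"
    if X: "X \<subseteq> D" for X
  proof (cases "card X = 2")
    case True
    then obtain d e where de: "X = {d, e}" "d \<noteq> e" by (rule obtain_two_elements)
    then have D': "d \<in> D" "e \<in> D" using X by auto
    have "thin_above 5 X \<le> thin_above 5 (h ` X)"
    proof (cases "d \<inter> e = {}")
      case True
      then show ?thesis using strict[OF D' de(2)] de(1) by simp
    next
      case False
      then show ?thesis using thin_above_eq_path[of d e "h d" "h e" 5] pair[OF D' de(2)] de by simp
    qed
    then show ?thesis using True by simp
  next
    case False
    then show ?thesis using eq[OF X] by simp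
  qed
  obtain d e where de: "d \<in> D" "e \<in> D" "d \<inter> e = {}"
    using D(2) unfolding pairwise_meeting_def by blast
  have "d \<noteq> {}" using de(1) D(1) by (auto simp: inner_def pairs_def)
  then have "d \<noteq> e" using de(3) by auto
  then have "connecting_avoiding 5 D < connecting_avoiding 5 D0"
    using connecting_avoiding_le(2)[OF D(1) D0(1) h le5, of "{d, e}"] de strict[OF de(1,2) _ de(3)] by simp
  moreover have "connecting_avoiding i D \<le> connecting_avoiding i D0" if "i < 5" for i
    using that eq by (intro connecting_avoiding_le(1)[OF D(1) D0(1) h]) simp
  ultimately show ?thesis by (rule lex_lessI[rotated])
qed

text \<open>
  All terms with \<open>card X \<le> 2\<close> agree, since in both families all pairs of edges form paths. The term of
  the whole family vanishes for \<open>i < 6\<close> and enters at \<open>i = 6\<close> with the sign of \<open>(-1)\<^sup>3\<close>, so the family with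
  fewer links has more connecting sets.
\<close>
lemma lex_less_star_triangle:
  assumes tri: "a \<in> V - T" "b \<in> V - T" "c \<in> V - T" "distinct [a, b, c]"
    and star: "u \<in> V - T" "x \<in> V - T" "y \<in> V - T" "z \<in> V - T" "distinct [u, x, y, z]"
  shows "lex_less (\<lambda>i. connecting_avoiding i {{u, x}, {u, y}, {u, z}})
    (\<lambda>i. connecting_avoiding i {{a, b}, {a, c}, {b, c}})"
proof -
  let ?D = "{{u, x}, {u, y}, {u, z}}" and ?R = "{{a, b}, {a, c}, {b, c}}"
  have I: "?D \<subseteq> inner" "?R \<subseteq> inner" using tri star unfolding inner_def pairs_iff by auto
  have c: "card ?D = 3" "card ?R = 3" using tri star by (auto simp: doubleton_eq_iff)
  have meet: "pairwise_meeting ?D" "pairwise_meeting ?R" unfolding pairwise_meeting_def by auto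
  obtain h where h: "bij_betw h ?D ?R"
    using finite_same_card_bij[of ?D ?R] c by auto
  have im: "h ` ?D = ?R" using h by (simp add: bij_betw_def)
  have eq: "thin_above i X = thin_above i (h ` X)" if X: "X \<subseteq> ?D" "X \<noteq> ?D \<or> i < 6" for i X
  proof (cases "X = ?D")
    case True
    then have "i < 6" using X(2) by blast
    then have "thin_above i ?D = 0" "thin_above i ?R = 0"
      using I c by (auto intro: thin_above_eq_0)
    then show ?thesis by (simp only: True im)
  next
    case False
    then have "card X < card ?D" using X(1) by (intro psubset_card_mono) auto
    then have "card X \<le> 2" using c by simp
    then show ?thesis by (rule thin_above_eq_meeting[OF I h meet X(1)])
  qed
  have "card (links ?R) < card (links ?D)"
    by (rule card_links_triangle_lt_star[OF tri star])
  then have "thin_above 6 ?R < thin_above 6 ?D"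
    using thin_above_links[OF I(1)] thin_above_links[OF I(2)] unfolding c by simp
  then have less: "(-1) ^ card ?D * int (thin_above 6 ?D) < (-1) ^ card ?D * int (thin_above 6 (h ` ?D))"
    unfolding im c by simp
  have le: "(-1) ^ card X * int (thin_above 6 X) \<le> (-1) ^ card X * int (thin_above 6 (h ` X))"
    if X: "X \<subseteq> ?D" for X
  proof (cases "X = ?D")
    case True then show ?thesis using less by (simp only: less_imp_le)
  next
    case False then show ?thesis using eq[OF X, of 6] by simp
  qed
  have "connecting_avoiding 6 ?D < connecting_avoiding 6 ?R"
    by (rule connecting_avoiding_le(2)[OF I h le order_refl less])
  moreover have "connecting_avoiding i ?D \<le> connecting_avoiding i ?R" if i: "i < 6" for i
  proof (rule connecting_avoiding_le(1)[OF I h])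
    fix X assume "X \<subseteq> ?D"
    then have "thin_above i X = thin_above i (h ` X)" using i eq by blast
    then show "(-1) ^ card X * int (thin_above i X) \<le> (-1) ^ card X * int (thin_above i (h ` X))"
      by simp
  qed
  ultimately show ?thesis by (rule lex_lessI[rotated])
qed

end

section \<open>Optimal graphs with a missing star or triangle\<close>

lemma terminals_of_simple:
  "simple_tt_graph H \<Longrightarrow> terminals (verts H) (targets H)"
  by unfold_locales (auto simp: simple_tt_graph_def targets_def)

lemma num_connecting_eq_connecting_avoiding:
  assumes H: "simple_tt_graph H"
  shows "num_connecting H i = terminals.connecting_avoiding (verts H) (targets H) i (missing H)"
proof -
  interpret terminals "verts H" "targets H" using H by (rule terminals_of_simple)
  show ?thesis
    unfolding num_connecting_def connecting_avoiding_def edges_eq_pairs_minus_missing[OF H]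
      targets_connected_def connects_def ..
qed

lemma pairwise_meeting_image:
  "pairwise_meeting D \<Longrightarrow> pairwise_meeting ((`) f ` D)"
  unfolding pairwise_meeting_def by fast

lemma obtain_copy_num_connecting:
  assumes G: "simple_tt_graph G" and H: "simple_tt_graph H" and n: "card (verts G) = card (verts H)"
    and E: "card (edges G) = card (edges H)"
    and inner: "missing G \<subseteq> pairs (verts G - targets G)"
  obtains f D where
    "num_connecting G = (\<lambda>i. terminals.connecting_avoiding (verts H) (targets H) i D)"
    "D = (`) f ` missing G" "D \<subseteq> pairs (verts H - targets H)" "card D = card (missing H)"
    "bij_betw f (verts G) (verts H)" "f ` targets G = targets H"
proof -
  obtain G' f where G': "simple_tt_graph G'" "verts G' = verts H" "targets G' = targets H"
    "tt_isomorphic G G'" "missing G' = (`) f ` missing G"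
    and f: "bij_betw f (verts G) (verts H)" "f ` targets G = targets H"
    by (rule obtain_isomorphic_copy[OF G H n])
  have inj: "inj_on f (verts G)" and im: "f ` verts G = verts H" using f(1) by (auto simp: bij_betw_def)
  have TG: "targets G \<subseteq> verts G" using G by (simp add: simple_tt_graph_def)
  have "f ` (verts G - targets G) = verts H - targets H"
    using inj_on_image_set_diff[OF inj, of "verts G" "targets G"] TG im f(2) by auto
  then have "bij_betw f (verts G - targets G) (verts H - targets H)"
    by (intro bij_betw_subset[OF f(1)]) auto
  then have b: "bij_betw ((`) f) (pairs (verts G - targets G)) (pairs (verts H - targets H))"
    by (rule bij_betw_image_pairs)
  then have sub: "(`) f ` missing G \<subseteq> pairs (verts H - targets H)"
    using inner by (auto simp: bij_betw_def)
  have "inj_on ((`) f) (missing G)" using b inner by (auto simp: bij_betw_def intro: inj_on_subset)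
  then have "card ((`) f ` missing G) = card (missing H)"
    using card_missing[OF G] card_missing[OF H] n E by (simp add: card_image)
  moreover have "num_connecting G
      = (\<lambda>i. terminals.connecting_avoiding (verts H) (targets H) i ((`) f ` missing G))"
    using num_connecting_isomorphic[OF G G'(1,4)] num_connecting_eq_connecting_avoiding[OF G'(1)]
    by (simp add: G'(2,3,5) fun_eq_iff)
  ultimately show thesis using sub f by (intro that[of "(`) f ` missing G" f]) auto
qed

text \<open>
  The lexicographic comparison of \<open>N\<^sub>2\<close>, \<open>N\<^sub>3\<close> and \<open>N\<^sub>5\<close> in terms of graphs: what remains to be considered
  are competitors that miss a star or a triangle of inner edges.
\<close>
lemma lex_less_or_pairwise_meeting:
  assumes G: "simple_tt_graph G" and H: "simple_tt_graph H" and n: "card (verts G) = card (verts H)"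
    and E: "card (edges G) = card (edges H)"
    and D: "missing G \<subseteq> pairs (verts G - targets G)" "pairwise_meeting (missing G)"
  shows "lex_less (num_connecting H) (num_connecting G) \<or>
    missing H \<subseteq> pairs (verts H - targets H) \<and> pairwise_meeting (missing H)"
proof -
  obtain f D0 where D0:
    "num_connecting G = (\<lambda>i. terminals.connecting_avoiding (verts H) (targets H) i D0)"
    "D0 = (`) f ` missing G" "D0 \<subseteq> pairs (verts H - targets H)" "card D0 = card (missing H)"
    "bij_betw f (verts G) (verts H)" "f ` targets G = targets H"
    by (rule obtain_copy_num_connecting[OF G H n E D(1)])
  interpret terminals "verts H" "targets H" using H by (rule terminals_of_simple)
  have lex: "lex_less (num_connecting H) (num_connecting G)"
    if "lex_less (\<lambda>i. connecting_avoiding i (missing H)) (\<lambda>i. connecting_avoiding i D0)"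
    using that unfolding lex_less_def D0(1) num_connecting_eq_connecting_avoiding[OF H] by simp
  have D0I: "D0 \<subseteq> inner" "pairwise_meeting D0"
    using D0(2,3) D(2) pairwise_meeting_image[of "missing G" f] by (auto simp: inner_def)
  have miss: "missing H \<subseteq> pairs (verts H)" by (simp add: missing_def)
  consider "missing H \<inter> pairs (targets H) \<noteq> {}"
    | "missing H \<inter> pairs (targets H) = {}" "\<not> missing H \<subseteq> inner"
    | "missing H \<subseteq> inner" "\<not> pairwise_meeting (missing H)"
    | "missing H \<subseteq> inner" "pairwise_meeting (missing H)" by blast
  then show ?thesis
  proof cases
    case 1
    then show ?thesis using lex lex_less_if_target_edge_missing D0I by blast
  next
    case 2
    then show ?thesis
      using lex lex_less_if_target_incident_edge_missing[OF miss 2 D0I(1)] D0(4) by simp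
  next
    case 3
    then show ?thesis
      using lex lex_less_if_disjoint_missing_edges[OF 3 D0I] D0(4) by simp
  next
    case 4
    then show ?thesis by (simp add: inner_def)
  qed
qed

lemma star_center_inj: "c \<notin> L \<Longrightarrow> inj_on (\<lambda>x. {c, x}) L"
  by (auto simp: inj_on_def doubleton_eq_iff)

lemma isomorphic_if_missing_stars:
  assumes G: "simple_tt_graph G" and H: "simple_tt_graph H" and n: "card (verts G) = card (verts H)"
    and starG: "c \<in> verts G - targets G" "L \<subseteq> verts G - targets G - {c}" "missing G = (\<lambda>x. {c, x}) ` L"
    and starH: "c' \<in> verts H - targets H" "L' \<subseteq> verts H - targets H - {c'}" "missing H = (\<lambda>x. {c', x}) ` L'"
    and card: "card (missing G) = card (missing H)"
  shows "tt_isomorphic G H"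
proof -
  have fin: "finite (verts G)" "finite (verts H)" and TG: "targets G \<subseteq> verts G" "targets H \<subseteq> verts H"
    and T3: "card (targets G) = card (targets H)"
    using G H by (auto simp: simple_tt_graph_def targets_def)
  have fL: "finite L" "finite L'" using starG(2) starH(2) fin by (auto intro: finite_subset)
  have cL: "card L = card L'"
    using card starG(2) starH(2) unfolding starG(3) starH(3)
    by (subst (asm) (1 2) card_image) (auto intro: star_center_inj)
  obtain xs where xs: "set xs = L" "distinct xs" using finite_distinct_list[OF fL(1)] by blast
  obtain ys where ys: "set ys = L'" "distinct ys" using finite_distinct_list[OF fL(2)] by blast
  have len: "length (c # xs) = length (c' # ys)"
    using cL xs ys by (auto simp: distinct_card[symmetric])
  obtain f where f: "bij_betw f (verts G) (verts H)" "f ` targets G = targets H"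
    "map f (c # xs) = c' # ys"
    by (rule bij_betw_prescribed[OF fin TG n T3, of "c # xs" "c' # ys"])
      (use starG starH xs ys len in auto)
  have "f ` L = L'" "f c = c'" using f(3) xs(1) ys(1) set_map[of f xs] by simp_all
  then have "(`) f ` missing G = missing H"
    unfolding starG(3) starH(3) by (auto simp: image_image)
  then show ?thesis using tt_isomorphic_if_missing[OF G H f(1,2)] by blast
qed

lemma isomorphic_if_missing_triangles:
  assumes G: "simple_tt_graph G" and H: "simple_tt_graph H" and n: "card (verts G) = card (verts H)"
    and triG: "{a, b, c} \<subseteq> verts G - targets G" "distinct [a, b, c]" "missing G = {{a, b}, {a, c}, {b, c}}"
    and triH: "{a', b', c'} \<subseteq> verts H - targets H" "distinct [a', b', c']" "missing H = {{a', b'}, {a', c'}, {b', c'}}"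
  shows "tt_isomorphic G H"
proof -
  have fin: "finite (verts G)" "finite (verts H)" and TG: "targets G \<subseteq> verts G" "targets H \<subseteq> verts H"
    and T3: "card (targets G) = card (targets H)"
    using G H by (auto simp: simple_tt_graph_def targets_def)
  obtain f where f: "bij_betw f (verts G) (verts H)" "f ` targets G = targets H"
    "map f [a, b, c] = [a', b', c']"
    by (rule bij_betw_prescribed[OF fin TG n T3, of "[a, b, c]" "[a', b', c']"])
      (use triG triH in auto)
  have "(`) f ` missing G = missing H"
    unfolding triG(3) triH(3) using f(3) by simp
  then show ?thesis using tt_isomorphic_if_missing[OF G H f(1,2)] by blast
qed

lemma unique_if_missing_star:
  fixes G :: "'a tt_graph"
  assumes G: "G \<in> tt_graphs n m" and star: "c \<in> verts G - targets G" "L \<subseteq> verts G - targets G - {c}"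
    "missing G = (\<lambda>x. {c, x}) ` L" and L: "2 \<le> card L" "card L \<noteq> 3"
  shows "unique_locally_most_reliable_near_0 n m G"
proof (rule unique_locally_most_reliable_if_lex_greatest[OF G])
  fix H :: "'a tt_graph" assume "H \<in> tt_graphs n m"
  then have H: "simple_tt_graph H" "card (verts G) = card (verts H)" "card (edges G) = card (edges H)"
    and G': "simple_tt_graph G" using G by (auto simp: tt_graphs_def)
  have cD: "card (missing G) = card L"
    unfolding star(3) by (rule card_image, rule star_center_inj) (use star(2) in auto)
  have cH: "card (missing H) = card L"
    using card_missing[OF G'] card_missing[OF H(1)] H cD by simp
  have "missing G \<subseteq> pairs (verts G - targets G)" unfolding star(3) pairs_iff using star(1,2) by blast
  moreover have "pairwise_meeting (missing G)" unfolding star(3) pairwise_meeting_def by auto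
  ultimately have "lex_less (num_connecting H) (num_connecting G) \<or>
      missing H \<subseteq> pairs (verts H - targets H) \<and> pairwise_meeting (missing H)"
    by (rule lex_less_or_pairwise_meeting[OF G' H])
  then show "tt_isomorphic G H \<or> lex_less (num_connecting H) (num_connecting G)"
  proof
    assume DH: "missing H \<subseteq> pairs (verts H - targets H) \<and> pairwise_meeting (missing H)"
    then have "missing H \<subseteq> pairs (verts H - targets H)" "pairwise_meeting (missing H)"
      "2 \<le> card (missing H)" using L cH by auto
    then show ?thesis
    proof (cases rule: pairwise_meeting_cases)
      case (star c' L')
      then have "tt_isomorphic G H"
        using isomorphic_if_missing_stars[OF G' H(1,2) assms(2-4), of c' L'] cH cD by simp
      then show ?thesis ..
    next
      case (triangle a b c)
      then have "card (missing H) = 3" by (auto simp: doubleton_eq_iff)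
      then show ?thesis using cH L(2) by simp
    qed
  qed blast
qed

lemma unique_if_missing_triangle:
  fixes G :: "'a tt_graph"
  assumes G: "G \<in> tt_graphs n m" and tri: "{a, b, c} \<subseteq> verts G - targets G" "distinct [a, b, c]"
    "missing G = {{a, b}, {a, c}, {b, c}}"
  shows "unique_locally_most_reliable_near_0 n m G"
proof (rule unique_locally_most_reliable_if_lex_greatest[OF G])
  fix H :: "'a tt_graph" assume "H \<in> tt_graphs n m"
  then have H: "simple_tt_graph H" "card (verts G) = card (verts H)" "card (edges G) = card (edges H)"
    and G': "simple_tt_graph G" using G by (auto simp: tt_graphs_def)
  have cD: "card (missing G) = 3"
    unfolding tri(3) using tri(2) by (auto simp: doubleton_eq_iff)
  have cH: "card (missing H) = 3"
    using card_missing[OF G'] card_missing[OF H(1)] H cD by simp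
  have inG: "missing G \<subseteq> pairs (verts G - targets G)" unfolding tri(3) pairs_iff using tri(1,2) by auto
  moreover have "pairwise_meeting (missing G)" unfolding tri(3) pairwise_meeting_def by auto
  ultimately have "lex_less (num_connecting H) (num_connecting G) \<or>
      missing H \<subseteq> pairs (verts H - targets H) \<and> pairwise_meeting (missing H)"
    by (rule lex_less_or_pairwise_meeting[OF G' H])
  then show "tt_isomorphic G H \<or> lex_less (num_connecting H) (num_connecting G)"
  proof
    assume DH: "missing H \<subseteq> pairs (verts H - targets H) \<and> pairwise_meeting (missing H)"
    then have "missing H \<subseteq> pairs (verts H - targets H)" "pairwise_meeting (missing H)"
      "2 \<le> card (missing H)" using cH by auto
    then show ?thesis
    proof (cases rule: pairwise_meeting_cases)
      case (triangle a' b' c')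
      then have "tt_isomorphic G H"
        using isomorphic_if_missing_triangles[OF G' H(1,2) tri, of a' b' c'] by simp
      then show ?thesis ..
    next
      case (star u L)
      have "card L = 3"
        using cH star(2) unfolding star(3) by (subst (asm) card_image) (auto intro: star_center_inj)
      then obtain x y z where L: "L = {x, y, z}" "x \<noteq> y" "y \<noteq> z" "x \<noteq> z"
        unfolding card_3_iff by blast
      obtain f D0 where D0:
        "num_connecting G = (\<lambda>i. terminals.connecting_avoiding (verts H) (targets H) i D0)" "D0 = (`) f ` missing G"
          "D0 \<subseteq> pairs (verts H - targets H)" "card D0 = card (missing H)"
        and f: "bij_betw f (verts G) (verts H)" "f ` targets G = targets H"
        by (rule obtain_copy_num_connecting[OF G' H inG])
      interpret terminals "verts H" "targets H" using H(1) by (rule terminals_of_simple)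
      have inj: "inj_on f (verts G)" using f by (simp add: bij_betw_def)
      have TG: "targets G \<subseteq> verts G" using G' by (simp add: simple_tt_graph_def)
      have fW: "f v \<in> verts H - targets H" if "v \<in> verts G - targets G" for v
        using that f TG inj inj_on_image_mem_iff[OF inj, of v "targets G"] by (auto simp: bij_betw_def)
      have D0tri: "D0 = {{f a, f b}, {f a, f c}, {f b, f c}}" unfolding D0(2) tri(3) by simp
      have DHstar: "missing H = {{u, x}, {u, y}, {u, z}}" unfolding star(3) L(1) by simp
      have dist: "distinct [f a, f b, f c]" using tri(1,2) inj by (auto simp: inj_on_eq_iff)
      have "lex_less (\<lambda>i. connecting_avoiding i (missing H)) (\<lambda>i. connecting_avoiding i D0)"
        unfolding D0tri DHstar
        by (rule lex_less_star_triangle[OF fW fW fW dist]) (use tri(1) star(1,2) L in auto)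
      then have "lex_less (num_connecting H) (num_connecting G)"
        unfolding lex_less_def D0(1) num_connecting_eq_connecting_avoiding[OF H(1)] by simp
      then show ?thesis ..
    qed
  qed blast
qed

section \<open>The graphs of the theorem\<close>

lemma labelled_pairs:
  assumes v: "inj_on v {1..n::nat}"
  shows "{{v i, v j} | i j. 1 \<le> i \<and> i < j \<and> j \<le> n} = pairs (v ` {1..n})"
proof (intro equalityI subsetI)
  fix e assume "e \<in> {{v i, v j} | i j. 1 \<le> i \<and> i < j \<and> j \<le> n}"
  then obtain i j where ij: "e = {v i, v j}" "1 \<le> i" "i < j" "j \<le> n" by blast
  then have "v i \<noteq> v j" using v by (auto simp: inj_on_eq_iff)
  then show "e \<in> pairs (v ` {1..n})" using ij unfolding pairs_def by auto
next
  fix e assume "e \<in> pairs (v ` {1..n})"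
  then obtain i j where ij: "e = {v i, v j}" "i \<in> {1..n}" "j \<in> {1..n}" "v i \<noteq> v j"
    unfolding pairs_iff by blast
  then have "i < j \<or> j < i" by (metis nat_neq_iff)
  then show "e \<in> {{v i, v j} | i j. 1 \<le> i \<and> i < j \<and> j \<le> n}"
    using ij by (auto simp: insert_commute)
qed

lemma graph_with_missing_edges:
  fixes G :: "'a tt_graph"
  assumes V: "finite (verts G)" "card (verts G) = n" "card (targets G) = 3" "targets G \<subseteq> verts G"
    and D: "D \<subseteq> pairs (verts G)" "edges G = pairs (verts G) - D" "card D = l"
  shows "G \<in> tt_graphs n ((n choose 2) - l)" "missing G = D"
proof -
  have "target_r G \<noteq> target_s G \<and> target_r G \<noteq> target_t G \<and> target_s G \<noteq> target_t G"
    using V(3) unfolding targets_def by (auto simp: card_insert_if split: if_splits)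
  moreover have "edges G \<subseteq> pairs (verts G)" using D(2) by blast
  ultimately have "simple_tt_graph G"
    using V(1,4) unfolding simple_tt_graph_def pairs_iff by (elim conjE) (intro conjI; assumption)
  moreover have "card (edges G) = (n choose 2) - l"
    using D V(1,2) finite_pairs[OF V(1)] n_subsets[OF V(1), of 2]
    by (simp add: card_Diff_subset finite_subset pairs_def)
  ultimately show "G \<in> tt_graphs n ((n choose 2) - l)" using V by (simp add: tt_graphs_def)
  show "missing G = D" using D by (auto simp: missing_def)
qed

theorem theorem3p1:
  fixes n l m :: nat and v :: "nat \<Rightarrow> 'a"
  assumes "n \<ge> 7" and "2 \<le> l" and "l \<le> n - 4" and "m = (n choose 2) - l"
    and "inj_on v {1..n}"
  shows "(l = 3 \<longrightarrow> unique_locally_most_reliable_near_0 n m (graph_A_star v n)) \<and>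
         (l \<noteq> 3 \<longrightarrow> unique_locally_most_reliable_near_0 n m (graph_A v n l))"
proof -
  note n = assms(1) and l = assms(2,3) and m = assms(4) and v = assms(5)
  let ?V = "v ` {1..n}" and ?T = "{v 1, v 2, v 3}"
  have v_eq: "v i = v j \<longleftrightarrow> i = j" if "i \<in> {1..n}" "j \<in> {1..n}" for i j
    using v that by (simp add: inj_on_eq_iff)
  have V: "finite ?V" "card ?V = n" using v by (auto simp: card_image)
  have T: "card ?T = 3" "?T \<subseteq> ?V" using n v_eq by auto
  have W: "v i \<in> ?V - ?T" if "4 \<le> i" "i \<le> n" for i
    using that n v_eq[of i 1] v_eq[of i 2] v_eq[of i 3] by auto
  have A: "verts (graph_A v n l) = ?V" "targets (graph_A v n l) = ?T" for l
    by (simp_all add: graph_A_def targets_def)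
  have star_eq: "{{v 4, v (i + 3)} | i. 2 \<le> i \<and> i \<le> l + 1} = (\<lambda>x. {v 4, x}) ` v ` {5..l + 4}" for l
  proof (intro equalityI subsetI)
    fix e assume "e \<in> (\<lambda>x. {v 4, x}) ` v ` {5..l + 4}"
    then obtain k where k: "e = {v 4, v k}" "5 \<le> k" "k \<le> l + 4" by auto
    then show "e \<in> {{v 4, v (i + 3)} | i. 2 \<le> i \<and> i \<le> l + 1}"
      by (intro CollectI exI[of _ "k - 3"]) auto
  qed auto
  have EA: "edges (graph_A v n l) = pairs ?V - (\<lambda>x. {v 4, x}) ` v ` {5..l + 4}" for l
    unfolding graph_A_def labelled_pairs[OF v] star_eq by simp
  have "unique_locally_most_reliable_near_0 n m (graph_A v n l)" if "l \<noteq> 3"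
  proof -
    let ?L = "v ` {5..l + 4}"
    have L: "?L \<subseteq> ?V - ?T - {v 4}"
    proof
      fix x assume "x \<in> ?L"
      then obtain i where i: "x = v i" "5 \<le> i" "i \<le> l + 4" by auto
      then show "x \<in> ?V - ?T - {v 4}" using W[of i] v_eq[of i 4] l n by simp
    qed
    have c4: "v 4 \<in> ?V - ?T" using W[of 4] n by simp
    have "inj_on v {5..l + 4}" by (rule inj_on_subset[OF v]) (use l n in auto)
    then have cL: "card ?L = l" by (simp add: card_image)
    have cD: "card ((\<lambda>x. {v 4, x}) ` ?L) = l"
      using L cL by (subst card_image) (auto intro: star_center_inj)
    have D: "(\<lambda>x. {v 4, x}) ` ?L \<subseteq> pairs (verts (graph_A v n l))"
      unfolding A pairs_iff using L c4 by blast
    have G: "graph_A v n l \<in> tt_graphs n m" "missing (graph_A v n l) = (\<lambda>x. {v 4, x}) ` ?L"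
      using graph_with_missing_edges[of "graph_A v n l" n, OF _ _ _ _ D _ cD] EA V T m by (simp_all add: A)
    show ?thesis
      by (rule unique_if_missing_star[OF G(1) _ _ G(2)]) (use L c4 cL l that in \<open>auto simp: A\<close>)
  qed
  moreover have "unique_locally_most_reliable_near_0 n m (graph_A_star v n)" if l3: "l = 3"
  proof -
    let ?G = "graph_A_star v n" and ?D = "{{v 4, v 5}, {v 4, v 6}, {v 5, v 6}}"
    have AS: "verts ?G = ?V" "targets ?G = ?T"
      using A[of 3] by (simp_all add: graph_A_star_def targets_def)
    have ne: "v 4 \<noteq> v 5" "v 4 \<noteq> v 6" "v 4 \<noteq> v 7" "v 5 \<noteq> v 6" "v 5 \<noteq> v 7" "v 6 \<noteq> v 7"
      using v_eq n by auto
    have "{5..3 + 4} = {5, 6, 7 :: nat}" by auto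
    then have "edges ?G = (pairs ?V - {{v 4, v 5}, {v 4, v 6}, {v 4, v 7}}) \<union> {{v 4, v 7}} - {{v 5, v 6}}"
      by (simp add: graph_A_star_def EA)
    also have "\<dots> = pairs ?V - ?D"
    proof -
      have "{v 4, v 7} \<in> pairs ?V" using ne n unfolding pairs_def by auto
      moreover have "{v 4, v 7} \<notin> ?D" using ne by (auto simp: doubleton_eq_iff)
      ultimately show ?thesis by blast
    qed
    finally have E: "edges ?G = pairs (verts ?G) - ?D" by (simp add: AS)
    have W': "{v 4, v 5, v 6} \<subseteq> ?V - ?T" using W[of 4] W[of 5] W[of 6] n by simp
    have D: "?D \<subseteq> pairs (verts ?G)" unfolding AS pairs_def using W' ne by auto
    have cD: "card ?D = l" using ne l3 by (auto simp: doubleton_eq_iff)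
    have G: "?G \<in> tt_graphs n m" "missing ?G = ?D"
      using graph_with_missing_edges[of ?G n, OF _ _ _ _ D E cD] V T m by (simp_all add: AS)
    show ?thesis
      by (rule unique_if_missing_triangle[OF G(1) _ _ G(2)]) (use W' ne in \<open>auto simp: AS\<close>)
  qed
  ultimately show ?thesis by blast
qed

end
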